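(* Let $m\ge 2$ be an integer and let $A=(a_{i_1\cdots i_m})$ be a $2$-dimensional $m$th order complex hypermatrix which has only finitely many equivalence classes of eigenpairs. Then the leading coefficient $a_{h(m,2)}(m,2)$ of the E-characteristic polynomial $\psi_A(\lambda)$ is $$a_{h(m,2)}(m,2)=(P_m^2+Q_m^2)^{\frac{m-2}{2}}\quad\text{if } m \text{ is even},$$ $$a_{h(m,2)}(m,2)=-(P_m^2+Q_m^2)^{m-2}\quad\text{if } m \text{ is odd},$$ with $P_m,Q_m$ as defined in the context.
   Context: For $x=(x_1,x_2)^T\in\mathbb{C}^2$, $Ax^{m-1}$ is the vector with components $(Ax^{m-1})_i=\sum_{i_2,\dots,i_m=1}^2 a_{ii_2\cdots i_m}x_{i_2}\cdots x_{i_m}$, and $x^Tx=x_1^2+x_2^2$. An eigenpair of $A$ is $(\lambda,x)$ with $\lambda\in\mathbb{C}$, $x\in\mathbb{C}^2\setminus\{0\}$, $Ax^{m-1}=\lambda x$; $(\lambda,x)$ and $(\lambda',x')$ are equivalent if $\lambda'=t^{m-2}\lambda$, $x'=tx$ for some complex $t\neq0$. $\mathrm{Res}$ is the classical multipolynomial resultant of $N$ forms of prescribed degrees in $N$ variables, normalized by $\mathrm{Res}(x_1^{d_1},\dots,x_N^{d_N})=1$. The E-characteristic polynomial: for $m$ even, $\psi_A(\lambda)=\mathrm{Res}_x\big(Ax^{m-1}-\lambda(x^Tx)^{(m-2)/2}x\big)=\sum_{j=0}^{h(m,2)}a_j(m,2)\lambda^j$; for $m$ odd, $\psi_A(\lambda)$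 is the resultant in $(x_1,x_2,x_0)$ of the two components of $Ax^{m-1}-\lambda x_0^{m-2}x$ and of $x^Tx-x_0^2$, written $\psi_A(\lambda)=\sum_{j=0}^{h(m,2)}a_j(m,2)\lambda^{2j}$. The $a_j(m,2)$ are polynomials in the entries of $A$, and $h(m,2)$ is the largest $j$ for which $a_j(m,2)$ is not the zero polynomial in these entries; it is known that $h(m,2)=1+(m-1)=m$. So the leading coefficient is the coefficient of $\lambda^m$ ($m$ even) or $\lambda^{2m}$ ($m$ odd), which may vanish for particular $A$. For $j=1,\dots,m$: $b_j$ is the sum of all $a_{1i_2\cdots i_m}$ such that exactly $j-1$ of $i_2,\dots,i_m$ equal $2$, and $c_j$ is the sum of all $a_{2i_2\cdots i_m}$ such that exactly $j-1$ of $i_2,\dots,i_m$ equal $2$. $P_m$ and $Q_m$ are the sums of the first $m$ terms of, respectively, $$b_1-c_2-b_3+c_4+b_5-c_6-b_7+c_8+\cdots,\qquad c_1+b_2-c_3-b_4+c_5+b_6-c_7-b_8+\cdots,$$ the signs repeating with period four and the letters $b,c$ alternating. A zeroth power is understood to be $1$. *)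

theory Defs
  imports "HOL-Analysis.Analysis" "HOL-Computational_Algebra.Polynomial"
    "HOL-Library.Poly_Mapping"
begin

section \<open>Multivariate polynomials\<close>

text \<open>
  Polynomials in the variables \<open>'v\<close> with coefficients in \<open>'a\<close> are finitely supported functions
  from exponent vectors to coefficients; HOL-Library makes them a commutative ring under
  convolution, so \<open>+\<close>, \<open>*\<close>, \<open>^\<close>, \<open>dvd\<close> and \<open>irreducible\<close> have their usual meaning on them.
\<close>

type_synonym 'v monom = "'v \<Rightarrow>\<^sub>0 nat"
type_synonym ('v, 'a) mpoly = "'v monom \<Rightarrow>\<^sub>0 'a"

definition var :: "'v \<Rightarrow> ('v, 'a::comm_ring_1) mpoly" where
  "var v = Poly_Mapping.single (Poly_Mapping.single v 1) 1"

definition const :: "'a::comm_ring_1 \<Rightarrow> ('v, 'a) mpoly" where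
  "const c = Poly_Mapping.single 0 c"

definition mdeg :: "'v monom \<Rightarrow> nat" where
  "mdeg \<alpha> = (\<Sum>v\<in>Poly_Mapping.keys \<alpha>. Poly_Mapping.lookup \<alpha> v)"

definition homogeneous :: "nat \<Rightarrow> ('v, 'a::comm_ring_1) mpoly \<Rightarrow> bool" where
  "homogeneous n p \<longleftrightarrow> (\<forall>\<alpha>\<in>Poly_Mapping.keys p. mdeg \<alpha> = n)"

text \<open>
  Evaluation at \<open>x\<close>; the coefficients are transported by \<open>\<phi>\<close> (a ring homomorphism in all uses).
\<close>

definition meval :: "('a::comm_ring_1 \<Rightarrow> 'b::comm_ring_1) \<Rightarrow> ('v \<Rightarrow> 'b) \<Rightarrow> ('v, 'a) mpoly \<Rightarrow> 'b" where
  "meval \<phi> x p = (\<Sum>\<mu>\<in>Poly_Mapping.keys p. \<phi> (Poly_Mapping.lookup p \<mu>) *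
     (\<Prod>v\<in>Poly_Mapping.keys \<mu>. x v ^ Poly_Mapping.lookup \<mu> v))"

section \<open>The multipolynomial resultant\<close>

text \<open>
  The forms and the variables are both indexed by the finite type \<open>'v\<close>, so that \<open>N = CARD('v)\<close>;
  the form with index \<open>i\<close> has degree \<open>d i\<close>.  The indeterminate \<open>(i, \<alpha>)\<close> of the resultant stands
  for the coefficient of the monomial \<open>\<alpha>\<close> in the form with index \<open>i\<close>.
\<close>

type_synonym 'v res_poly = "('v \<times> 'v monom, complex) mpoly"

text \<open>
  Value of \<open>R\<close> at the coefficients of the forms \<open>F\<close>, whose coefficients may lie in any ring
  receiving the complex numbers through \<open>\<phi>\<close>.
\<close>

definition res_at :: "(complex \<Rightarrow> 'a::comm_ring_1) \<Rightarrow> 'v res_poly \<Rightarrow> ('v \<Rightarrow> ('v, 'a) mpoly) \<Rightarrow> 'a" where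
  "res_at \<phi> R F = meval \<phi> (\<lambda>(i, \<alpha>). Poly_Mapping.lookup (F i) \<alpha>) R"

text \<open>
  \<open>R\<close> is the resultant of forms of degrees \<open>d\<close>: the irreducible polynomial in the coefficients
  that vanishes exactly when the forms have a common nontrivial complex zero, homogeneous of
  degree \<open>\<Prod>j\<noteq>i. d j\<close> in the coefficients of the form with index \<open>i\<close>, normalized to the value 1
  at the forms \<open>x\<^sub>i ^ d i\<close>.  Irreducibility, the vanishing condition and the normalization already
  single out one polynomial (its coefficients are then integers).
\<close>

definition is_resultant :: "('v::finite \<Rightarrow> nat) \<Rightarrow> 'v res_poly \<Rightarrow> bool" where
  "is_resultant d R \<longleftrightarrow>
     (\<forall>\<mu>\<in>Poly_Mapping.keys R. \<forall>(i, \<alpha>)\<in>Poly_Mapping.keys \<mu>. mdeg \<alpha> = d i) \<and>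
     irreducible R \<and>
     (\<forall>F. (\<forall>i. homogeneous (d i) (F i)) \<longrightarrow>
        (res_at id R F = 0 \<longleftrightarrow> (\<exists>x. (\<exists>i. x i \<noteq> 0) \<and> (\<forall>i. meval id x (F i) = 0)))) \<and>
     (\<forall>\<mu>\<in>Poly_Mapping.keys R. \<forall>i.
        (\<Sum>(k, \<alpha>)\<in>{v \<in> Poly_Mapping.keys \<mu>. fst v = i}. Poly_Mapping.lookup \<mu> (k, \<alpha>))
          = (\<Prod>j\<in>UNIV - {i}. d j)) \<and>
     res_at id R (\<lambda>i. var i ^ d i) = 1"

section \<open>Hypermatrices and eigenpairs\<close>

text \<open>
  A 2-dimensional hypermatrix of order \<open>m\<close> is a function on index lists of length \<open>m\<close> over the
  two-element type \<open>2\<close>, whose elements are \<open>1\<close> and \<open>2\<close>; values at lists of other lengths are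
  never used.  The vector \<open>A x\<^sup>m\<^sup>-\<^sup>1\<close> is defined over any commutative ring because it is needed
  both for complex vectors and for vectors of polynomial variables.
\<close>

definition tensor_apply :: "nat \<Rightarrow> (2 list \<Rightarrow> 'a::comm_ring_1) \<Rightarrow> (2 \<Rightarrow> 'a) \<Rightarrow> 2 \<Rightarrow> 'a" where
  "tensor_apply m A x i = (\<Sum>is | length is = m - 1. A (i # is) * prod_list (map x is))"

definition eigenpairs :: "nat \<Rightarrow> (2 list \<Rightarrow> complex) \<Rightarrow> (complex \<times> (complex ^ 2)) set" where
  "eigenpairs m A = {(l, x). x \<noteq> 0 \<and> (\<chi> i. tensor_apply m A (($) x) i) = l *s x}"

definition eigenpair_equiv ::
  "nat \<Rightarrow> (2 list \<Rightarrow> complex) \<Rightarrow> ((complex \<times> (complex ^ 2)) \<times> (complex \<times> (complex ^ 2))) set" where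
  "eigenpair_equiv m A = {((l, x), (l', x')).
     (l, x) \<in> eigenpairs m A \<and> (l', x') \<in> eigenpairs m A \<and>
     (\<exists>t. t \<noteq> 0 \<and> l' = t ^ (m - 2) * l \<and> x' = t *s x)}"

section \<open>The E-characteristic polynomial\<close>

text \<open>
  The forms below have coefficients in \<open>complex poly\<close>, the ring of polynomials in \<open>\<lambda>\<close>, so their
  resultant is a polynomial in \<open>\<lambda>\<close>.  For odd \<open>m\<close> the variables are indexed by \<open>2 option\<close>:
  \<open>Some i\<close> is \<open>x\<^sub>i\<close> and \<open>None\<close> is \<open>x\<^sub>0\<close>.
\<close>

definition lam :: "('v, complex poly) mpoly" where
  "lam = const [:0, 1:]"

definition lift_tensor :: "(2 list \<Rightarrow> complex) \<Rightarrow> 2 list \<Rightarrow> ('v, complex poly) mpoly" where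
  "lift_tensor A is = const [:A is:]"

definition even_forms :: "nat \<Rightarrow> (2 list \<Rightarrow> complex) \<Rightarrow> 2 \<Rightarrow> (2, complex poly) mpoly" where
  "even_forms m A i =
     tensor_apply m (lift_tensor A) var i - lam * (\<Sum>k\<in>UNIV. var k ^ 2) ^ ((m - 2) div 2) * var i"

definition odd_forms ::
  "nat \<Rightarrow> (2 list \<Rightarrow> complex) \<Rightarrow> 2 option \<Rightarrow> (2 option, complex poly) mpoly" where
  "odd_forms m A j = (case j of
     Some i \<Rightarrow> tensor_apply m (lift_tensor A) (\<lambda>k. var (Some k)) i
               - lam * var None ^ (m - 2) * var (Some i)
   | None \<Rightarrow> (\<Sum>k\<in>UNIV. var (Some k) ^ 2) - var None ^ 2)"

definition even_degrees :: "nat \<Rightarrow> 2 \<Rightarrow> nat" where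
  "even_degrees m i = m - 1"

definition odd_degrees :: "nat \<Rightarrow> 2 option \<Rightarrow> nat" where
  "odd_degrees m j = (case j of Some i \<Rightarrow> m - 1 | None \<Rightarrow> 2)"

text \<open>
  \<open>R2\<close> and \<open>R3\<close> are the resultants in two and three variables for the degrees
  \<open>even_degrees m\<close> and \<open>odd_degrees m\<close>.
\<close>

definition echar_poly ::
  "2 res_poly \<Rightarrow> 2 option res_poly \<Rightarrow> nat \<Rightarrow> (2 list \<Rightarrow> complex) \<Rightarrow> complex poly" where
  "echar_poly R2 R3 m A =
     (if even m then res_at (\<lambda>c. [:c:]) R2 (even_forms m A)
      else res_at (\<lambda>c. [:c:]) R3 (odd_forms m A))"

definition echar_coeff ::
  "2 res_poly \<Rightarrow> 2 option res_poly \<Rightarrow> nat \<Rightarrow> nat \<Rightarrow> (2 list \<Rightarrow> complex) \<Rightarrow> complex" where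
  "echar_coeff R2 R3 m j A =
     poly.coeff (echar_poly R2 R3 m A) (if even m then j else 2 * j)"

text \<open>
  \<open>echar_coeff R2 R3 m j A\<close> is a polynomial in the entries of \<open>A\<close>; over the complex numbers it is
  the zero polynomial iff it vanishes for every \<open>A\<close>.
\<close>

definition echar_h :: "2 res_poly \<Rightarrow> 2 option res_poly \<Rightarrow> nat \<Rightarrow> nat" where
  "echar_h R2 R3 m = (GREATEST j. \<exists>A. echar_coeff R2 R3 m j A \<noteq> 0)"

section \<open>The sums in the leading coefficient\<close>

definition b_sum :: "nat \<Rightarrow> (2 list \<Rightarrow> complex) \<Rightarrow> nat \<Rightarrow> complex" where
  "b_sum m A j = (\<Sum>is | length is = m - 1 \<and> count_list is 2 = j - 1. A (1 # is))"

definition c_sum :: "nat \<Rightarrow> (2 list \<Rightarrow> complex) \<Rightarrow> nat \<Rightarrow> complex" where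
  "c_sum m A j = (\<Sum>is | length is = m - 1 \<and> count_list is 2 = j - 1. A (2 # is))"

definition P_sum :: "nat \<Rightarrow> (2 list \<Rightarrow> complex) \<Rightarrow> complex" where
  "P_sum m A = (\<Sum>j = 1..m. (if j mod 4 \<in> {0, 1} then 1 else - 1) *
     (if odd j then b_sum m A j else c_sum m A j))"

definition Q_sum :: "nat \<Rightarrow> (2 list \<Rightarrow> complex) \<Rightarrow> complex" where
  "Q_sum m A = (\<Sum>j = 1..m. (if j mod 4 \<in> {1, 2} then 1 else - 1) *
     (if odd j then c_sum m A j else b_sum m A j))"

end

theory Submission
  imports Defs "HOL-Computational_Algebra.Fundamental_Theorem_Algebra"
begin

text \<open>
  In the coordinates \<open>u = x\<^sub>1 + \<i> x\<^sub>2\<close>, \<open>v = x\<^sub>1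
      - \<i> x\<^sub>2\<close> the two forms become
  \<open>p - \<lambda> w u\<close> and \<open>q - \<lambda> w v\<close>,
      where \<open>w\<close> is \<open>(u v) ^ ((m - 2) / 2)\<close> for even \<open>m\<close> and
  \<open>x\<^sub>0 ^ (m - 2)\<close>
      for odd \<open>m\<close>. For odd \<open>m\<close> the conic \<open>u v
          = x\<^sub>0\<^sup>2\<close> is a rational curve, so in both cases
  the resultant is one of two binary forms of a degree \<open>N\<close>, homogeneous of degree
      \<open>N\<close> in each of them.

  A polynomial in one parameter without zeros is constant; this replaces every explicit formula
  for the resultant. It fixes the normalization, and it gives the Poisson formula
  \<open>Res(f, g) = \<Prod> g(s)\<close> over the roots \<open>s\<close> of a monic \<open>f\<close>:
      the polynomial
  \<open>z \<mapsto> Res(f, g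
      + z)\<close> has degree at most \<open>N\<close>, coefficient 1 at \<open>z ^ N\<close>, and the
          roots \<open>- g(s)\<close>.

  The form \<open>h = v p
      - u q\<close> does not involve \<open>\<lambda>\<close>, and at the roots of \<open>p
          - \<lambda> w u\<close> it equals
  \<open>- u\<close> times the second form. Exchanging the two products turns the Poisson formula into
      a product over the roots of
  \<open>h\<close> of factors that are linear in \<open>\<lambda>\<close>, from which the degree and
      the leading coefficient in \<open>\<lambda>\<close> are
  read off: up to constants the latter is a power of \<open>p(0, 1) q(1, 0)\<close>, that is of
      \<open>(P + \<i> Q) (P - \<i> Q)\<close>.
\<close>

section \<open>Polynomial functions of two complex parameters\<close>

text \<open>The inner variable of \<open>Q\<close> is \<open>x\<close>, the outer one is
  \<open>y\<close>. Only existence of a representation is recorded, so closure rules show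
  polynomiality of a resultant in parameters without computing it.\<close>

definition bipoly :: "(complex \<Rightarrow> complex \<Rightarrow> complex) \<Rightarrow> bool" where
  "bipoly F \<longleftrightarrow> (\<exists>Q :: complex poly poly. \<forall>x y. F x y
      = poly (poly Q [:y:]) x)"

lemma bipoly_const: "bipoly (\<lambda>x y. c)"
  unfolding bipoly_def by (intro exI[of _ "[:[:c:]:]"]) simp

lemma bipoly_fst: "bipoly (\<lambda>x y. x)"
  unfolding bipoly_def by (intro exI[of _ "[:[:0, 1:]:]"]) simp

lemma bipoly_snd: "bipoly (\<lambda>x y. y)"
  unfolding bipoly_def by (intro exI[of _ "[:0, 1:]"]) simp

lemma bipoly_add:
  assumes "bipoly F" "bipoly G"
  shows "bipoly (\<lambda>x y. F x y + G x y)"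
proof -
  obtain P Q where "\<And>x y. F x y = poly (poly P [:y:]) x" "\<And>x y. G x y = poly (poly Q [:y:]) x"
    using assms unfolding bipoly_def by blast
  then show ?thesis
    unfolding bipoly_def by (intro exI[of _ "P + Q"]) simp
qed

lemma bipoly_mult:
  assumes "bipoly F" "bipoly G"
  shows "bipoly (\<lambda>x y. F x y * G x y)"
proof -
  obtain P Q where "\<And>x y. F x y = poly (poly P [:y:]) x" "\<And>x y. G x y = poly (poly Q [:y:]) x"
    using assms unfolding bipoly_def by blast
  then show ?thesis
    unfolding bipoly_def by (intro exI[of _ "P * Q"]) simp
qed

lemma bipoly_minus:
  assumes "bipoly F" "bipoly G"
  shows "bipoly (\<lambda>x y. F x y - G x y)"
  using bipoly_add[OF assms(1) bipoly_mult[OF bipoly_const[of "-1"] assms(2)]] by simp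

lemma bipoly_sum: "(\<And>i. i \<in> I \<Longrightarrow> bipoly (F i))
    \<Longrightarrow> bipoly (\<lambda>x y. \<Sum>i\<in>I. F i x y)"
  by (induction I rule: infinite_finite_induct) (auto intro: bipoly_const bipoly_add)

lemma bipoly_prod: "(\<And>i. i \<in> I \<Longrightarrow> bipoly (F i))
    \<Longrightarrow> bipoly (\<lambda>x y. \<Prod>i\<in>I. F i x y)"
  by (induction I rule: infinite_finite_induct) (auto intro: bipoly_const bipoly_mult)

lemma bipoly_power: "bipoly F \<Longrightarrow> bipoly (\<lambda>x y. F x y ^ n)"
  by (induction n) (auto intro: bipoly_const bipoly_mult)

lemmas bipoly_intros = bipoly_const bipoly_fst bipoly_snd bipoly_add bipoly_minus bipoly_mult
  bipoly_sum bipoly_prod bipoly_power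

lemma bipoly_poly_fst:
  assumes "bipoly F"
  obtains q where "\<And>x. F x y = poly q x"
  using assms unfolding bipoly_def by blast

text \<open>Read as a polynomial in \<open>y\<close>, the function has coefficients that are
  themselves polynomials in \<open>x\<close>. This lets an identity between coefficients spread from
  generic \<open>x\<close> to every \<open>x\<close>.\<close>

lemma bipoly_poly_snd:
  assumes "bipoly F"
  obtains Q :: "complex poly poly"
  where "\<And>x y. F x y = poly (map_poly (\<lambda>c. poly c x) Q) y"
proof -
  obtain Q where Q: "\<And>x y. F x y = poly (poly Q [:y:]) x"
    using assms unfolding bipoly_def by blast
  have eq: "poly (poly R [:y:]) x = poly (map_poly (\<lambda>c. poly c x) R) y" for x y and R ::
      "complex poly poly"
    by (induction R) (simp_all add: map_poly_pCons)
  show thesis by (rule that[of Q]) (simp only: Q eq)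
qed

lemma poly_nonvanishing_imp_constant:
  fixes q :: "complex poly"
  assumes "\<And>z. poly q z \<noteq> 0"
  shows "poly q x = poly q y"
proof -
  have "constant (poly q)" using fundamental_theorem_of_algebra[of q] assms by blast
  then show ?thesis by (simp add: constant_def)
qed

lemma poly_eq_if_cofinitely_equal:
  fixes p q :: "complex poly"
  assumes "finite S" "\<And>z. z \<notin> S \<Longrightarrow> poly p z = poly q z"
  shows "p = q"
proof (rule ccontr)
  assume "p \<noteq> q"
  then have "finite {z. poly (p - q) z = 0}" by (intro poly_roots_finite) simp
  moreover have "- S \<subseteq> {z. poly (p - q) z = 0}" using assms(2) by auto
  ultimately have "finite (- S)" by (rule rev_finite_subset)
  then show False using assms(1) infinite_UNIV_char_0[where 'a = complex] by simp
qed

lemma finite_affine_zeros: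
  fixes a b :: complex
  assumes "b \<noteq> 0"
  shows "finite {z. a + z * b = 0}"
  using poly_roots_finite[of "[:a, b:]"] assms by simp

section \<open>The resultant of two binary forms\<close>

text \<open>Binary forms of degree \<open>N\<close> are represented
    by univariate polynomials of degree at most
  \<open>N\<close>; the second alternative in \<open>Phi_eq_0_iff\<close> is a common zero at
      infinity.\<close>

locale binary_resultant =
  fixes N :: nat and Phi :: "complex poly \<Rightarrow> complex poly \<Rightarrow> complex"
  assumes N_pos: "N > 0"
    and bipoly_Phi: "\<And>f g. (\<And>k. bipoly (\<lambda>x y. poly.coeff (f x y) k)) \<Longrightarrow>
      (\<And>k. bipoly (\<lambda>x y. poly.coeff (g x y) k))
          \<Longrightarrow> bipoly (\<lambda>x y. Phi (f x y) (g x y))"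
    and Phi_smult_left: "\<And>a f g. Phi (smult a f) g = a ^ N * Phi f g"
    and Phi_smult_right: "\<And>a f g. Phi f (smult a g) = a ^ N * Phi f g"
    and Phi_eq_0_iff: "\<And>f g. degree f \<le> N \<Longrightarrow> degree g \<le> N \<Longrightarrow>
      Phi f g = 0 \<longleftrightarrow> (\<exists>s. poly f s = 0 \<and> poly g s = 0) \<or>
        (poly.coeff f N = 0 \<and> poly.coeff g N = 0)"
begin

text \<open>A pair moved along a complex line on which the resultant never vanishes keeps its
  resultant, which is a polynomial in \<open>t\<close> without zeros; compare \<open>t = 0\<close>
  and \<open>t = 1\<close>.\<close>

lemma Phi_deform:
  assumes "\<And>t. Phi (f + smult t f') (g + smult t g') \<noteq> 0"
  shows "Phi (f + f') (g + g') = Phi f g"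
proof -
  have "bipoly (\<lambda>x y. Phi (f + smult x f') (g + smult x g'))"
    by (rule bipoly_Phi) (auto intro!: bipoly_intros)
  then obtain q where q: "\<And>t. Phi (f + smult t f') (g + smult t g') = poly q t"
    by (rule bipoly_poly_fst[where y = 0]) blast
  have "poly q 1 = poly q 0"
    by (rule poly_nonvanishing_imp_constant) (simp add: assms flip: q)
  then show ?thesis by (simp flip: q)
qed

text \<open>The locale assumptions survive multiplication of \<open>Phi\<close> by a nonzero
  constant; \<open>K\<close> records that constant.\<close>

abbreviation K :: complex where "K \<equiv> Phi (monom 1 N) 1"

text \<open>On the segment from \<open>f\<close> to \<open>monom 1 N\<close> the coefficient at
  \<open>N\<close> stays 1, which excludes a common zero at infinity, and the form 1 has no finite
  zero.\<close>

lemma Phi_monic_one: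
  assumes "degree f \<le> N" "poly.coeff f N = 1"
  shows "Phi f 1 = K"
proof -
  have "Phi (f + smult t (monom 1 N - f)) (1 + smult t 0) \<noteq> 0" for t
  proof -
    have "degree (f + smult t (monom 1 N - f)) \<le> N"
      using assms by (intro degree_add_le order.trans[OF degree_smult_le] degree_diff_le degree_monom_le)
    then show ?thesis using assms by (subst Phi_eq_0_iff) simp_all
  qed
  from Phi_deform[OF this] show ?thesis by simp
qed

text \<open>Adding multiples of \<open>f\<close> to \<open>g\<close> does not change the common
  zeros. So the resultant is zero for all multiples, or for none, and then deformation
  applies.\<close>

lemma Phi_add_smult_right:
  assumes "degree f \<le> N" "degree g \<le> N"
  shows "Phi f (g + smult a f) = Phi f g"
proof -
  have eq0: "Phi f (g + smult t f) = 0 \<longleftrightarrow> Phi f g = 0" for t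
  proof -
    have "degree (g + smult t f) \<le> N"
      using assms by (intro degree_add_le order.trans[OF degree_smult_le])
    then show ?thesis using assms by (subst (1 2) Phi_eq_0_iff) auto
  qed
  show ?thesis
  proof (cases "Phi f g = 0")
    case False
    have "Phi (f + smult t 0) (g + smult t (smult a f)) \<noteq> 0" for t
      using eq0[of "t * a"] False by simp
    from Phi_deform[OF this] show ?thesis by simp
  qed (simp add: eq0)
qed

lemma Phi_add_smult_left:
  assumes "degree f \<le> N" "degree g \<le> N"
  shows "Phi (f + smult a g) g = Phi f g"
proof -
  have eq0: "Phi (f + smult t g) g = 0 \<longleftrightarrow> Phi f g = 0" for t
  proof -
    have "degree (f + smult t g) \<le> N"
      using assms by (intro degree_add_le order.trans[OF degree_smult_le])
    then show ?thesis using assms by (subst (1 2) Phi_eq_0_iff) (auto, force+)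
  qed
  show ?thesis
  proof (cases "Phi f g = 0")
    case False
    have "Phi (f + smult t (smult a g)) (g + smult t 0) \<noteq> 0" for t
      using eq0[of "t * a"] False by simp
    from Phi_deform[OF this] show ?thesis by simp
  qed (simp add: eq0)
qed

text \<open>The change of pair has determinant \<open>- 2 * \<i>\<close>, and it splits into one
  scaling and two additions of a multiple of one form to the other.\<close>

lemma Phi_rotate:
  assumes "degree f \<le> N" "degree g \<le> N"
  shows "Phi (f + smult \<i> g) (f - smult \<i> g) = (- 2 * \<i>) ^ N * Phi f g"
proof -
  have d: "degree (f + smult \<i> g) \<le> N"
    using assms by (intro degree_add_le order.trans[OF degree_smult_le])
  have e: "degree (smult (- 2 * \<i>) g) \<le> N"
    using assms by (intro order.trans[OF degree_smult_le])
  have "f - smult \<i> g = smult (- 2 * \<i>) g + smult 1 (f + smult \<i> g)"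
    by (rule poly_eqI) (simp add: algebra_simps)
  then have "Phi (f + smult \<i> g) (f - smult \<i> g) = Phi (f + smult \<i> g) (smult (- 2 * \<i>) g)"
    using Phi_add_smult_right[OF d e, of 1] by (simp only:)
  also have "\<dots> = (- 2 * \<i>) ^ N * Phi (f + smult \<i> g) g"
    by (rule Phi_smult_right)
  also have "Phi (f + smult \<i> g) g = Phi f g"
    by (rule Phi_add_smult_left[OF assms])
  finally show ?thesis .
qed

text \<open>Homogeneity in the second form gives
  \<open>Phi f (g + z h) = z ^ N * Phi f (h + g / z)\<close>. The right side is \<open>z ^ N\<close>
  times a polynomial in \<open>1 / z\<close>, which bounds the degree and shows the top
  coefficient.\<close>

lemma Phi_pencil:
  obtains q where "degree q \<le> N" "poly.coeff q N = Phi f h" "\<And>z. poly q z = Phi f (g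
      + smult z h)"
proof -
  have "bipoly (\<lambda>x y. Phi f (g + smult x h))" "bipoly (\<lambda>x y. Phi f (h + smult x g))"
    by (rule bipoly_Phi; auto intro!: bipoly_intros)+
  then obtain q r where q: "\<And>z. Phi f (g + smult z h) = poly q z"
    and r: "\<And>z. Phi f (h + smult z g) = poly r z"
    by (elim bipoly_poly_fst[where y = 0]) blast
  define e where "e = degree r"
  \<comment> \<open>The degree \<open>e\<close> of \<open>r\<close> is not yet known to be at most
    \<open>N\<close>, so both sides are multiplied by the \<open>e\<close>-th power of the variable
    before comparison.\<close>
  have "monom 1 e * q = monom 1 N * reflect_poly r"
  proof (rule poly_eq_if_cofinitely_equal[of "{0}"])
    fix z :: complex assume "z \<notin> {0}"
    then have z: "z \<noteq> 0" by simp
    have "poly q z = Phi f (smult z (h + smult (inverse z) g))"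
      using z by (simp add: q[symmetric] smult_add_right add.commute)
    also have "\<dots> = z ^ N * poly r (inverse z)"
      by (simp add: Phi_smult_right r)
    finally show "poly (monom 1 e * q) z = poly (monom 1 N * reflect_poly r) z"
      using z by (simp add: poly_monom poly_reflect_poly_nz e_def)
  qed simp
  then have coeffs: "poly.coeff (monom 1 e * q) (j + e) = poly.coeff (monom 1 N * reflect_poly r) (j
      + e)" for j
    by simp
  have c: "poly.coeff q j = (if j + e < N then 0 else poly.coeff (reflect_poly r) (j + e - N))" for j
    using coeffs[of j] by (simp add: coeff_monom_mult)
  have "degree q \<le> N"
  proof (rule degree_le, intro allI impI)
    fix j assume "N < j"
    then have "j + e - N > degree (reflect_poly r)"
      using degree_reflect_poly_le[of r] by (simp add: e_def)
    then show "poly.coeff q j = 0" by (simp add: c coeff_eq_0)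
  qed
  moreover have "poly.coeff q N = Phi f h"
    using r[of 0] by (simp add: c coeff_reflect_poly e_def poly_0_coeff_0)
  ultimately show thesis by (intro that[of q]) (simp_all add: q)
qed

text \<open>If \<open>g\<close> separates the points of \<open>S\<close>, then
  \<open>z \<mapsto> Phi f (g + z)\<close> has \<open>N\<close> distinct known roots; with the
  degree bound and the coefficient \<open>K\<close> at \<open>N\<close> these determine it.\<close>

lemma Phi_prod_roots_separated:
  assumes "card S = N" "degree g \<le> N" "inj_on (poly g) S"
  shows "Phi (\<Prod>s\<in>S. [:- s, 1:]) g = K * (\<Prod>s\<in>S. poly g s)"
proof -
  have fin: "finite S" using assms(1) N_pos by (metis card.infinite less_irrefl)
  define f where "f = (\<Prod>s\<in>S. [:- s, 1:])"
  have degf: "degree f = N" unfolding f_def by (subst degree_prod_sum_eq) (auto simp: assms(1))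
  have lead: "lead_coeff f = 1" unfolding f_def by (simp add: lead_coeff_prod)
  have f0: "poly f s = 0" if "s \<in> S" for s
    using that fin by (auto simp: f_def poly_prod)
  obtain q where q: "degree q \<le> N" "poly.coeff q N = Phi f 1" "\<And>z. poly q z = Phi f (g
      + smult z 1)"
    using Phi_pencil by blast
  have K: "Phi f 1 = K" by (rule Phi_monic_one) (use degf lead in auto)
  define q' where "q' = smult K (\<Prod>s\<in>S. [:poly g s, 1:])"
  have degp: "degree (\<Prod>s\<in>S. [:poly g s, 1:]) = N"
    by (subst degree_prod_sum_eq) (auto simp: assms(1))
  have "q = q'"
  proof (rule poly_eqI_degree_lead_coeff[where n = N and A = "(\<lambda>s. - poly g s) ` S"])
    have "lead_coeff (\<Prod>s\<in>S. [:poly g s, 1:]) = 1" by (simp add: lead_coeff_prod)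
    then show "poly.coeff q N = poly.coeff q' N" by (simp add: q K q'_def degp)
    show "N \<le> card ((\<lambda>s. - poly g s) ` S)"
      using assms by (subst card_image) (auto simp: inj_on_def)
    show "degree q \<le> N" by fact
    show "degree q' \<le> N" unfolding q'_def using degree_smult_le degp by metis
  next
    fix z assume "z \<in> (\<lambda>s. - poly g s) ` S"
    then obtain s where s: "s \<in> S" "z = - poly g s" by blast
    have "degree (g + smult z 1) \<le> N" using assms by (intro degree_add_le) auto
    then have "Phi f (g + smult z 1) = 0"
      using s f0 degf by (subst Phi_eq_0_iff) auto
    moreover have "poly q' z = 0" unfolding q'_def using s fin by (auto simp: poly_prod)
    ultimately show "poly q z = poly q' z" by (simp add: q)
  qed
  then have "poly q 0 = poly q' 0" by simp
  then show ?thesis by (simp add: q q'_def poly_prod f_def)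
qed

text \<open>Injectivity is removed by perturbation: \<open>g + z X\<close> separates
  \<open>S\<close> for all but finitely many \<open>z\<close>, and both sides are polynomials in
  \<open>z\<close>.\<close>

lemma Phi_prod_roots:
  assumes "card S = N" "degree g \<le> N"
  shows "Phi (\<Prod>s\<in>S. [:- s, 1:]) g = K * (\<Prod>s\<in>S. poly g s)"
proof -
  have fin: "finite S" using assms(1) N_pos by (metis card.infinite less_irrefl)
  define f where "f = (\<Prod>s\<in>S. [:- s, 1:])"
  have "bipoly (\<lambda>x y. Phi f (g + smult x [:0, 1:]))"
    by (rule bipoly_Phi) (auto simp del: smult_pCons intro!: bipoly_intros)
  then obtain q where q: "\<And>x. Phi f (g + smult x [:0, 1:]) = poly q x"
    by (rule bipoly_poly_fst[where y = 0]) blast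
  \<comment> \<open>For each pair of distinct points, at most one \<open>z\<close> gives them the
    same value.\<close>
  define E where "E = (\<Union>(s, t)\<in>{(s, t). s \<in> S \<and> t \<in> S
      \<and> s \<noteq> t}. {z. (poly g s - poly g t) + z * (s - t) = 0})"
  have "finite {(s, t). s \<in> S \<and> t \<in> S \<and> s \<noteq> t}"
    by (rule finite_subset[of _ "S \<times> S"]) (use fin in auto)
  then have "finite E" unfolding E_def by (auto intro!: finite_affine_zeros)
  have "q = smult K (\<Prod>s\<in>S. [:poly g s, s:])"
  proof (rule poly_eq_if_cofinitely_equal[OF \<open>finite E\<close>])
    fix z assume z: "z \<notin> E"
    have "inj_on (poly (g + smult z [:0, 1:])) S"
    proof (rule inj_onI, rule ccontr)
      fix s t assume *: "s \<in> S" "t \<in> S" "poly (g + smult z [:0, 1:]) s = poly (g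
          + smult z [:0, 1:]) t" "s \<noteq> t"
      then have "(poly g s - poly g t) + z * (s - t) = 0" by (simp add: algebra_simps)
      then show False using * z unfolding E_def by blast
    qed
    moreover have "degree (g + smult z [:0, 1:]) \<le> N"
      using assms N_pos by (intro degree_add_le order.trans[OF degree_smult_le]) auto
    ultimately have "Phi f (g + smult z [:0, 1:]) = K * (\<Prod>s\<in>S. poly (g + smult z [:0, 1:]) s)"
      unfolding f_def by (intro Phi_prod_roots_separated assms(1))
    then show "poly q z = poly (smult K (\<Prod>s\<in>S. [:poly g s, s:])) z"
      by (simp add: q[symmetric] poly_prod mult.commute)
  qed
  then have "poly q 0 = K * (\<Prod>s\<in>S. poly g s)" by (simp add: poly_prod)
  then show ?thesis using q[of 0] by (simp add: f_def)
qed

lemma Phi_poisson: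
  assumes "degree f = N" "rsquarefree f" "degree g \<le> N"
  shows "Phi f g = K * lead_coeff f ^ N * (\<Prod>s | poly f s = 0. poly g s)"
    and "card {s. poly f s = 0} = N"
proof -
  define S where "S = {s. poly f s = 0}"
  have f: "f = smult (lead_coeff f) (\<Prod>s\<in>S. [:- s, 1:])"
    unfolding S_def by (rule complex_poly_decompose_rsquarefree[OF assms(2), symmetric])
  have "f \<noteq> 0" using assms N_pos by auto
  then have "degree f = degree (\<Prod>s\<in>S. [:- s, 1:])"
    by (subst f) simp
  also have "\<dots> = card S" by (subst degree_prod_sum_eq) auto
  finally have card: "card S = N" using assms by simp
  then show "card {s. poly f s = 0} = N" by (simp add: S_def)
  show "Phi f g = K * lead_coeff f ^ N * (\<Prod>s | poly f s = 0. poly g s)"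
    unfolding S_def[symmetric]
    by (subst f, subst Phi_smult_left, subst Phi_prod_roots[OF card assms(3)]) simp
qed

end

section \<open>Degree and leading coefficient of the resultant in lambda\<close>

lemma coeff_prod_linear:
  fixes p q :: "nat \<Rightarrow> 'a::comm_ring_1"
  shows "poly.coeff (\<Prod>i<n. [:p i, q i:]) n = (\<Prod>i<n. q i)"
    and "j > n \<Longrightarrow> poly.coeff (\<Prod>i<n. [:p i, q i:]) j = 0"
proof (induction n arbitrary: j)
  case (Suc n)
  have c: "poly.coeff (f * [:a, b:]) (Suc k) = poly.coeff f (Suc k) * a + poly.coeff f k * b"
    for f :: "'a poly" and a b k
    by (simp add: mult.commute)
  {
    case 1
    show ?case using Suc by (simp add: c del: mult_pCons_right)
  next
    case 2
    then obtain k where "j = Suc k" "k > n" by (cases j) auto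
    then show ?case using Suc(2)[of k] Suc(2)[of "Suc k"] by (simp add: c del: mult_pCons_right)
  }
qed auto

context binary_resultant
begin

text \<open>In the affine chart \<open>v = 1\<close> with \<open>u = X ^ c\<close>, the exponents
  \<open>M\<close> and \<open>M - c\<close> are those of \<open>w u\<close> and \<open>w v\<close>.
  Then \<open>P1 - X ^ c * P2\<close> is free of lambda; the assumptions on \<open>P1\<close> and
  \<open>P2\<close> give it exact degree \<open>N + c = 2 * M\<close> and permit division by
  \<open>P1(0)\<close>.\<close>

lemma Phi_lambda_generic:
  fixes P1 P2 :: "complex poly"
  assumes c: "1 \<le> c" "c \<le> M" "N + c = 2 * M"
    and deg: "degree P1 \<le> N" "degree P2 \<le> N"
    and P1: "poly P1 0 \<noteq> 0" "poly.coeff P1 N \<noteq> 0"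
    and b: "poly.coeff P2 N \<noteq> 0"
    and Q: "\<And>l. poly Q l = Phi (P1 - smult l (monom 1 M)) (P2 - smult l (monom 1 (M - c)))"
  shows "j > 2 * M \<Longrightarrow> poly.coeff Q j = 0"
    and "poly.coeff Q (2 * M) = K * (-1) ^ (c + M) * (poly.coeff P2 N * poly P1 0) ^ (M - c)"
proof -
  define b where "b = poly.coeff P2 N"
  have b0: "b \<noteq> 0" using b by (simp add: b_def)
  have MN: "M \<le> N" "M \<ge> 1" using c by auto
  define h where "h = P1 - monom 1 c * P2"
  have "poly.coeff P1 (N + c) = 0" using deg c(1) by (intro coeff_eq_0) simp
  then have lead_h: "poly.coeff h (N + c) = - b"
    by (simp add: h_def coeff_monom_mult b_def)
  have deg_h: "degree h = N + c"
  proof (rule antisym)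
    have "degree (monom 1 c * P2) \<le> N + c"
      using degree_mult_le[of "monom 1 c" P2] degree_monom_le[of "1::complex" c] deg by linarith
    then show "degree h \<le> N + c" unfolding h_def using deg by (intro degree_diff_le) auto
    show "N + c \<le> degree h" using lead_h b0 by (intro le_degree) auto
  qed
  obtain r where "smult (lead_coeff h) (\<Prod>i<degree h. [:- r i, 1:]) = h"
    by (rule complex_poly_decompose')
  then have h: "h = smult (- b) (\<Prod>i<N + c. [:- r i, 1:])"
    by (simp add: deg_h lead_h)
  \<comment> \<open>A double root \<open>s\<close> of \<open>P1 - l X ^ M\<close> satisfies
    \<open>s P1'(s) = M P1(s)\<close>, so \<open>D(s) = 0\<close> and
    \<open>l = P1(s) / s ^ M\<close>. Hence only finitely many \<open>l\<close> give double roots.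
    The extra element of \<open>E\<close> is the value of \<open>l\<close> that cancels the top
    coefficient when \<open>M = N\<close>.\<close>
  define D where "D = [:0, 1:] * pderiv P1 - smult (of_nat M) P1"
  have "poly D 0 \<noteq> 0" using P1 MN by (simp add: D_def)
  then have "D \<noteq> 0" by auto
  define E where "E = (\<lambda>s. poly P1 s / s ^ M) ` {s. poly D s = 0} \<union> {poly.coeff P1 N}"
  have finE: "finite E" unfolding E_def using poly_roots_finite[OF \<open>D \<noteq> 0\<close>] by auto
  \<comment> \<open>The outcome of exchanging the two products. The factor \<open>P1(0) ^ c\<close>
    in \<open>main\<close> arises since multiplying each \<open>g2(s)\<close> by
    \<open>s ^ c\<close> brings in the product of the roots of \<open>g1\<close>.\<close>
  define T where "T = smult (K * (-1) ^ N * b ^ N) (\<Prod>i<N + c. [:poly P1 (r i), - (r i ^ M):])"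
  have main: "smult (poly P1 0 ^ c) Q = T"
  proof (rule poly_eq_if_cofinitely_equal[OF finE])
    fix l assume l: "l \<notin> E"
    define g1 where "g1 = P1 - smult l (monom 1 M)"
    define g2 where "g2 = P2 - smult l (monom 1 (M - c))"
    define a where "a = poly.coeff g1 N"
    have a0: "a \<noteq> 0" using l P1 by (auto simp: a_def g1_def E_def)
    have "degree g1 \<le> N"
      unfolding g1_def using deg MN
      by (intro degree_diff_le order.trans[OF degree_smult_le] order.trans[OF degree_monom_le]) auto
    then have deg1: "degree g1 = N" using a0 le_degree[of g1 N] by (simp add: a_def)
    have deg2: "degree g2 \<le> N"
      unfolding g2_def using deg MN
      by (intro degree_diff_le order.trans[OF degree_smult_le] order.trans[OF degree_monom_le]) auto
    have sqf: "rsquarefree g1"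
      unfolding rsquarefree_roots
    proof (intro allI notI)
      fix s assume s: "poly g1 s = 0 \<and> poly (pderiv g1) s = 0"
      then have 1: "poly P1 s = l * s ^ M" by (simp add: g1_def poly_monom)
      have s0: "s \<noteq> 0" using 1 P1 MN by (auto simp: zero_power)
      have "poly (pderiv P1) s = l * (of_nat M * s ^ (M - 1))"
        using s by (simp add: g1_def pderiv_diff pderiv_smult pderiv_monom poly_monom)
      moreover have "s * s ^ (M - 1) = s ^ M" using MN by (metis power_eq_if not_one_le_zero)
      ultimately have "s * poly (pderiv P1) s = of_nat M * poly P1 s"
        by (simp add: 1 algebra_simps)
      then have "poly D s = 0" by (simp add: D_def)
      moreover have "l = poly P1 s / s ^ M" using 1 s0 by simp
      ultimately show False using l unfolding E_def by blast
    qed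
    define S where "S = {s. poly g1 s = 0}"
    have Phi: "Phi g1 g2 = K * a ^ N * (\<Prod>s\<in>S. poly g2 s)" and card: "card S = N"
      using Phi_poisson[OF deg1 sqf deg2] by (simp_all add: S_def a_def deg1)
    have g1: "g1 = smult a (\<Prod>s\<in>S. [:- s, 1:])"
      using complex_poly_decompose_rsquarefree[OF sqf] by (simp add: S_def a_def deg1)
    \<comment> \<open>A product over the roots of \<open>g1\<close> is read as a value of
      \<open>g1\<close>; it is used at the roots of \<open>h\<close> and at 0.\<close>
    have aprod: "a * (\<Prod>s\<in>S. s - x) = (-1) ^ N * poly g1 x" for x
    proof -
      have "(\<Prod>s\<in>S. s - x) = (\<Prod>s\<in>S. - 1 * (x - s))" by (rule prod.cong) auto
      also have "\<dots> = (-1) ^ N * (\<Prod>s\<in>S. x - s)"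
          by (simp only: prod.distrib prod_constant card)
      finally show ?thesis by (subst g1) (simp add: poly_prod)
    qed
    \<comment> \<open>At a root \<open>s\<close> of \<open>g1\<close> the lambda terms cancel and
      \<open>s ^ c * g2(s) = - h(s)\<close>. Factoring \<open>h\<close> gives a double product whose
      order is then exchanged.\<close>
    have "(\<Prod>s\<in>S. s) ^ c * (\<Prod>s\<in>S. poly g2 s) = (\<Prod>s\<in>S. s ^ c * poly g2 s)"
      by (simp add: prod.distrib prod_power_distrib)
    also have "\<dots> = (\<Prod>s\<in>S. b * (\<Prod>i<N + c. s - r i))"
    proof (rule prod.cong)
      fix s assume "s \<in> S"
      then have "poly P1 s = l * s ^ M" by (simp add: S_def g1_def poly_monom)
      moreover have "s ^ c * s ^ (M - c) = s ^ M" using c by (simp flip: power_add)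
      ultimately have "s ^ c * poly g2 s = - poly h s"
        by (simp add: g2_def h_def poly_monom algebra_simps)
      also have "\<dots> = b * (\<Prod>i<N + c. s - r i)" by (subst h) (simp add: poly_prod)
      finally show "s ^ c * poly g2 s = b * (\<Prod>i<N + c. s - r i)" .
    qed simp
    also have "\<dots> = b ^ N * (\<Prod>i<N + c. \<Prod>s\<in>S. s - r i)"
      by (simp add: prod.distrib card prod.swap[of _ "{..<N + c}"])
    finally have XY: "(\<Prod>s\<in>S. s) ^ c * (\<Prod>s\<in>S. poly g2 s) = b ^ N * (\<Prod>i<N
        + c. \<Prod>s\<in>S. s - r i)" .
    have "poly g1 0 = poly P1 0" using MN by (simp add: g1_def poly_monom zero_power)
    then have P10: "poly P1 0 = (-1) ^ N * (a * (\<Prod>s\<in>S. s))"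
      using aprod[of 0] by simp
    have "poly P1 0 ^ c * Phi g1 g2
      = ((-1) ^ N) ^ c * K * (a ^ (N + c) * ((\<Prod>s\<in>S. s) ^ c * (\<Prod>s\<in>S. poly g2 s)))"
      by (simp add: Phi P10 power_mult_distrib power_add)
    also have "\<dots> = ((-1) ^ N) ^ c * K * b ^ N * (\<Prod>i<N + c. a * (\<Prod>s\<in>S. s - r i))"
      unfolding XY by (simp add: prod.distrib)
    also have "\<dots> = (((-1) ^ N) ^ c * ((-1) ^ N) ^ (N + c)) * K * b ^ N * (\<Prod>i<N
        + c. poly g1 (r i))"
      unfolding aprod by (simp add: prod.distrib)
    \<comment> \<open>The total exponent is \<open>N * N + 2 * N * c\<close>, of the same parity as
      \<open>N\<close>.\<close>
    also have "((-1) ^ N) ^ c * ((-1) ^ N) ^ (N + c) = (-1 :: complex) ^ N"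
      by (cases "even N") (simp_all flip: power_add)
    finally show "poly (smult (poly P1 0 ^ c) Q) l = poly T l"
      by (simp add: Q T_def poly_prod g1_def[symmetric] g2_def[symmetric])
        (simp add: g1_def poly_monom algebra_simps)
  qed
  show "poly.coeff Q j = 0" if "j > 2 * M"
  proof -
    have "poly P1 0 ^ c * poly.coeff Q j = poly.coeff T j" by (simp flip: main)
    also have "\<dots> = 0" using that c by (simp add: T_def coeff_prod_linear)
    finally show ?thesis using P1 by simp
  qed
  \<comment> \<open>The coefficient of \<open>T\<close> at \<open>2 * M\<close> contains the product
    of all roots of \<open>h\<close>. By Vieta it follows from the leading coefficient
    \<open>- b\<close> and from \<open>h(0)\<close>, which is \<open>P1(0)\<close> because
    \<open>c\<close> is positive.\<close>
  have "poly P1 0 = poly h 0" using c by (simp add: h_def poly_monom zero_power)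
  also have "\<dots> = - b * (\<Prod>i<2 * M. - r i)" by (subst h) (simp add: poly_prod c)
  also have "(\<Prod>i<2 * M. - r i) = (\<Prod>i<2 * M. -1 * r i)" by simp
  also have "\<dots> = (\<Prod>i<2 * M. r i)" by (simp only: prod.distrib prod_constant) simp
  finally have "(\<Prod>i<2 * M. r i) = (-1) * poly P1 0 / b" using b0 by (simp add: field_simps)
  moreover have "(\<Prod>i<2 * M. - (r i ^ M)) = (\<Prod>i<2 * M. - 1 * r i ^ M)" by simp
  moreover have "\<dots> = (\<Prod>i<2 * M. r i) ^ M"
    by (simp only: prod.distrib prod_constant prod_power_distrib) simp
  ultimately have pr: "(\<Prod>i<2 * M. - (r i ^ M)) = (-1) ^ M * poly P1 0 ^ M / b ^ M"
    by (simp only: power_divide power_mult_distrib)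
  have Nsplit: "N = M + (M - c)" "N + M + (c + M) = 2 * (2 * M)" using c by auto
  have bN: "b ^ N = b ^ M * b ^ (M - c)" unfolding power_add[symmetric] Nsplit(1)[symmetric] ..
  have "poly P1 0 ^ c * poly.coeff Q (2 * M) = poly.coeff T (2 * M)" by (simp flip: main)
  also have "\<dots> = K * (-1) ^ N * b ^ N * ((-1) ^ M * poly P1 0 ^ M / b ^ M)"
    by (simp only: T_def c coeff_smult coeff_prod_linear pr)
  also have "\<dots> = K * (-1) ^ (N + M) * (b ^ (M - c) * poly P1 0 ^ M)"
    using b0 by (simp add: power_add bN)
  also have "(-1 :: complex) ^ (N + M) = (-1) ^ (c + M)"
    using Nsplit(2) by (metis even_add even_mult_iff even_numeral neg_one_even_power neg_one_odd_power)
  also have "poly P1 0 ^ M = poly P1 0 ^ c * poly P1 0 ^ (M - c)"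
    using c by (simp flip: power_add)
  finally show "poly.coeff Q (2 * M) = K * (-1) ^ (c + M) * (poly.coeff P2 N * poly P1 0) ^ (M - c)"
    using P1 by (simp add: b_def power_mult_distrib algebra_simps)
qed

text \<open>Genericity is removed by adding \<open>x U\<close> and \<open>x V\<close>. These shift
  \<open>P1(0)\<close> and both top coefficients by exactly \<open>x\<close>, so only three values
  of \<open>x\<close> are bad. The coefficients in lambda are polynomials in \<open>x\<close>, and
  the identities extend to \<open>x = 0\<close>.\<close>

lemma Phi_lambda:
  fixes P1 P2 :: "complex poly"
  assumes c: "1 \<le> c" "c \<le> M" "N + c = 2 * M"
    and deg: "degree P1 \<le> N" "degree P2 \<le> N"
    and Q: "\<And>l. poly Q l = Phi (P1 - smult l (monom 1 M)) (P2 - smult l (monom 1 (M - c)))"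
  shows "j > 2 * M \<Longrightarrow> poly.coeff Q j = 0"
    and "poly.coeff Q (2 * M) = K * (-1) ^ (c + M) * (poly.coeff P2 N * poly P1 0) ^ (M - c)"
proof -
  define U :: "complex poly" where "U = 1 + monom 1 N"
  define V :: "complex poly" where "V = monom 1 N"
  have U: "degree U \<le> N" "poly U 0 = 1" "poly.coeff U N = 1"
    using N_pos by (auto simp: U_def poly_monom zero_power intro!: degree_add_le degree_monom_le)
  have V: "degree V \<le> N" "poly.coeff V N = 1"
    by (auto simp: V_def intro!: degree_monom_le)
  have "bipoly (\<lambda>x y. Phi (P1 + smult x U - smult y (monom 1 M)) (P2 + smult x V
      - smult y (monom 1 (M - c))))"
    by (rule bipoly_Phi) (auto simp del: coeff_monom intro!: bipoly_intros)
  then obtain R where R: "\<And>x y. Phi (P1 + smult x U - smult y (monom 1 M)) (P2 + smult x V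
      - smult y (monom 1 (M - c)))
      = poly (map_poly (\<lambda>p. poly p x) R) y"
    by (rule bipoly_poly_snd) blast
  have coeff_R: "poly.coeff (map_poly (\<lambda>p. poly p x) R) j = poly (poly.coeff R j) x" for x j
    by (simp add: coeff_map_poly)
  have Q0: "Q = map_poly (\<lambda>p. poly p 0) R"
    by
      (rule poly_eq_if_cofinitely_equal[of "{}"], use R[of 0] Q in simp_all)
  define E where "E = {z. poly P1 0 + z * 1 = 0} \<union> {z. poly.coeff P1 N + z * 1
      = 0} \<union> {z. poly.coeff P2 N + z * 1 = 0}"
  have finE: "finite E" unfolding E_def by (intro finite_UnI finite_affine_zeros) auto
  have gen: "(\<forall>j > 2 * M. poly (poly.coeff R j) x = 0) \<and>
     poly (poly.coeff R (2 * M)) x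
      = K * (-1) ^ (c + M) * ((poly.coeff P2 N + x) * (poly P1 0 + x)) ^ (M - c)" if "x \<notin> E" for x
  proof -
    have d: "degree (P1 + smult x U) \<le> N" "degree (P2 + smult x V) \<le> N"
      using deg U V by (auto intro!: degree_add_le order.trans[OF degree_smult_le])
    have nz: "poly (P1 + smult x U) 0 \<noteq> 0" "poly.coeff (P1 + smult x U) N \<noteq> 0"
      "poly.coeff (P2 + smult x V) N \<noteq> 0"
      using that by (auto simp: E_def U V)
    note gen = Phi_lambda_generic[OF c d nz, of "map_poly (\<lambda>p. poly p x) R", OF R[symmetric]]
    show ?thesis using gen by (auto simp: coeff_R U V)
  qed
  show "poly.coeff Q j = 0" if "j > 2 * M"
  proof -
    have "poly.coeff R j = 0"
      by (rule poly_eq_if_cofinitely_equal[OF finE]) (use gen that in simp)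
    then show ?thesis by (simp add: Q0 coeff_R)
  qed
  have "poly.coeff R (2 * M)
    = smult (K * (-1) ^ (c + M)) (([:poly.coeff P2 N, 1:] * [:poly P1 0, 1:]) ^ (M - c))"
    by (rule poly_eq_if_cofinitely_equal[OF finE])
      (use gen in \<open>simp add: poly_power algebra_simps\<close>)
  then have "poly.coeff Q (2 * M) = K * (-1) ^ (c + M) * (poly P1 0 * poly.coeff P2 N) ^ (M - c)"
    by (simp add: Q0 coeff_R poly_power)
  then show "poly.coeff Q (2 * M) = K * (-1) ^ (c + M) * (poly.coeff P2 N * poly P1 0) ^ (M - c)"
    by (simp only: mult.commute[of "poly P1 0"])
qed

end

section \<open>Evaluation and homogeneity of multivariate polynomials\<close>

lemma mpoly_sum_single: "p
    = (\<Sum>\<mu>\<in>Poly_Mapping.keys p. Poly_Mapping.single \<mu> (Poly_Mapping.lookup p \<mu>))"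
proof (rule poly_mapping_eqI)
  fix \<alpha>
  have "(\<Sum>\<mu>\<in>Poly_Mapping.keys p. Poly_Mapping.lookup (Poly_Mapping.single \<mu>
      (Poly_Mapping.lookup p \<mu>)) \<alpha>)
     = (\<Sum>\<mu>\<in>Poly_Mapping.keys p. if \<mu>
         = \<alpha> then Poly_Mapping.lookup p \<mu> else 0)"
    by (rule sum.cong) (auto simp: lookup_single)
  then show "Poly_Mapping.lookup p \<alpha> = Poly_Mapping.lookup
      (\<Sum>\<mu>\<in>Poly_Mapping.keys p. Poly_Mapping.single \<mu> (Poly_Mapping.lookup p \<mu>))
          \<alpha>"
    by (simp add: lookup_sum in_keys_iff)
qed

lemma lookup_const_mult: "Poly_Mapping.lookup (const c * p) \<alpha> = c
    * Poly_Mapping.lookup p \<alpha>"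
proof -
  have "const c * p = (\<Sum>\<mu>\<in>Poly_Mapping.keys p. Poly_Mapping.single \<mu> (c
      * Poly_Mapping.lookup p \<mu>))"
    by (subst (1) mpoly_sum_single[of p]) (simp add: const_def sum_distrib_left mult_single)
  moreover have "(\<Sum>\<mu>\<in>Poly_Mapping.keys p. Poly_Mapping.lookup (Poly_Mapping.single \<mu>
      (c * Poly_Mapping.lookup p \<mu>)) \<alpha>)
     = (\<Sum>\<mu>\<in>Poly_Mapping.keys p. if \<mu> = \<alpha> then c
         * Poly_Mapping.lookup p \<mu> else 0)"
    by (rule sum.cong) (auto simp: lookup_single)
  ultimately show ?thesis by (simp add: lookup_sum in_keys_iff)
qed

lemma const_add: "const (a + b) = const a + const b"
  by (simp add: const_def single_add)

lemma const_mult: "const (a * b) = const a * const b"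
  by (simp add: const_def mult_single)

lemma const_0 [simp]: "const 0 = 0"
  by (simp add: const_def)

lemma const_1 [simp]: "const 1 = 1"
  by (simp add: const_def)

lemma const_minus: "const (- a) = - const a"
  by (metis add_eq_0_iff const_0 const_add)

lemma const_diff: "const (a - b) = const a - const b"
  by (metis const_add const_minus uminus_add_conv_diff add.commute)

context
  fixes x :: "'v::finite \<Rightarrow> 'a::comm_ring_1"
begin

text \<open>With the product over all variables, its range no longer depends on the monomial, and
  adding exponents multiplies values term by term.\<close>

lemma meval_UNIV:
  "meval id x p = (\<Sum>\<mu>\<in>Poly_Mapping.keys p. Poly_Mapping.lookup p \<mu> *
     (\<Prod>v\<in>UNIV. x v ^ Poly_Mapping.lookup \<mu> v))"
proof -
  have "(\<Prod>v\<in>Poly_Mapping.keys \<mu>. x v ^ Poly_Mapping.lookup \<mu> v)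
     = (\<Prod>v\<in>UNIV. x v ^ Poly_Mapping.lookup \<mu> v)" for \<mu> :: "'v monom"
    by (rule prod.mono_neutral_left) (auto simp: in_keys_iff)
  then show ?thesis by (simp add: meval_def)
qed

lemma meval_superset:
  assumes "finite S" "Poly_Mapping.keys p \<subseteq> S"
  shows "meval id x p = (\<Sum>\<mu>\<in>S. Poly_Mapping.lookup p \<mu>
      * (\<Prod>v\<in>UNIV. x v ^ Poly_Mapping.lookup \<mu> v))"
  unfolding meval_UNIV by (rule sum.mono_neutral_left) (use assms in \<open>auto simp:
      in_keys_iff\<close>)

lemma meval_single:
  "meval id x (Poly_Mapping.single \<mu> c) = c * (\<Prod>v\<in>UNIV. x v ^ Poly_Mapping.lookup \<mu> v)"
  by (subst meval_superset[of "{\<mu>}"]) auto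

lemma meval_zero [simp]: "meval id x 0 = 0"
  by (simp add: meval_UNIV)

lemma meval_add: "meval id x (p + q) = meval id x p + meval id x q"
proof -
  have "Poly_Mapping.keys (p + q) \<subseteq> Poly_Mapping.keys p \<union> Poly_Mapping.keys q"
    by (rule Poly_Mapping.keys_add)
  then show ?thesis
    by (simp add: meval_superset[of "Poly_Mapping.keys p \<union> Poly_Mapping.keys q"]
        lookup_add algebra_simps sum.distrib)
qed

lemma meval_sum: "meval id x (sum f I) = (\<Sum>i\<in>I. meval id x (f i))"
  by (induction I rule: infinite_finite_induct)
    (simp_all add: meval_add[unfolded id_def] meval_zero[unfolded id_def])

lemma meval_mult: "meval id x (p * q) = meval id x p * meval id x q"
proof -
  have "meval id x (p * q) = meval id x
     ((\<Sum>\<mu>\<in>Poly_Mapping.keys p. Poly_Mapping.single \<mu> (Poly_Mapping.lookup p \<mu>)) *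
      (\<Sum>\<mu>\<in>Poly_Mapping.keys q. Poly_Mapping.single \<mu> (Poly_Mapping.lookup q \<mu>)))"
    by (simp flip: mpoly_sum_single)
  also have "\<dots> = meval id x p * meval id x q"
    by (simp add: sum_product mult_single meval_sum meval_single meval_UNIV[of p] meval_UNIV[of q]
        lookup_add power_add prod.distrib ac_simps)
  finally show ?thesis .
qed

lemma meval_const [simp]: "meval id x (const c) = c"
  by (simp add: const_def meval_single)

lemma meval_one [simp]: "meval id x 1 = 1"
  using meval_const[of 1] by simp

lemma meval_var [simp]: "meval id x (var v) = x v"
proof -
  have "(\<Prod>w\<in>UNIV. x w ^ Poly_Mapping.lookup (Poly_Mapping.single v (1::nat)) w)
     = (\<Prod>w\<in>UNIV. if w = v then x w else 1)"
    by (rule prod.cong) (auto simp: lookup_single)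
  then show ?thesis by (simp add: var_def meval_single)
qed

lemma meval_power: "meval id x (p ^ n) = meval id x p ^ n"
  by (induction n) (simp_all add: meval_mult[unfolded id_def] meval_one[unfolded id_def])

lemma meval_minus: "meval id x (- p) = - meval id x p"
  using meval_add[of p "- p"] by (simp add: add_eq_0_iff)

lemma meval_diff: "meval id x (p - q) = meval id x p - meval id x q"
  using meval_add[of p "- q"] by (simp add: meval_minus)

end

lemmas meval_simps = meval_add meval_mult meval_power meval_diff meval_minus meval_sum

section \<open>Homogeneity of sums, products and powers\<close>

lemma mdeg_UNIV: "mdeg (\<alpha> :: 'v::finite monom)
    = (\<Sum>v\<in>UNIV. Poly_Mapping.lookup \<alpha> v)"
  unfolding mdeg_def by (rule sum.mono_neutral_left) (auto simp: in_keys_iff)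

lemma homogeneous_mult:
  fixes p q :: "('v::finite, 'a::comm_ring_1) mpoly"
  assumes "homogeneous a p" "homogeneous b q"
  shows "homogeneous (a + b) (p * q)"
  unfolding homogeneous_def
proof
  fix \<alpha> assume "\<alpha> \<in> Poly_Mapping.keys (p * q)"
  then obtain \<beta> \<gamma> where "\<alpha> = \<beta> + \<gamma>"
      "\<beta> \<in> Poly_Mapping.keys p" "\<gamma> \<in> Poly_Mapping.keys q"
    using keys_mult[of p q] by blast
  then show "mdeg \<alpha> = a + b"
    using assms by (simp add: homogeneous_def mdeg_UNIV lookup_add sum.distrib)
qed

lemma homogeneous_add: "homogeneous a p \<Longrightarrow> homogeneous a q
    \<Longrightarrow> homogeneous a (p + q)"
  unfolding homogeneous_def using Poly_Mapping.keys_add[of p q] by blast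

lemma homogeneous_minus: "homogeneous a p \<Longrightarrow> homogeneous a (- p)"
  unfolding homogeneous_def by (simp add: in_keys_iff)

lemma homogeneous_diff: "homogeneous a p \<Longrightarrow> homogeneous a q
    \<Longrightarrow> homogeneous a (p - q)"
  using homogeneous_add[of a p "- q"] homogeneous_minus[of a q] by simp

lemma homogeneous_sum: "(\<And>i. i \<in> I \<Longrightarrow> homogeneous a (f i))
    \<Longrightarrow> homogeneous a (sum f I)"
  by (induction I rule: infinite_finite_induct) (auto simp: homogeneous_add, auto simp: homogeneous_def)

lemma homogeneous_const: "homogeneous 0 (const c :: ('v::finite, 'a::comm_ring_1) mpoly)"
  by (auto simp: homogeneous_def const_def mdeg_UNIV)

lemma homogeneous_var: "homogeneous 1 (var v :: ('v::finite, 'a::comm_ring_1) mpoly)"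
proof -
  have "(\<Sum>w\<in>UNIV. Poly_Mapping.lookup (Poly_Mapping.single v (1::nat)) w)
      = (\<Sum>w\<in>UNIV. if w = v then 1 else 0)"
    by (rule sum.cong) (auto simp: lookup_single)
  then show ?thesis by (auto simp: homogeneous_def var_def mdeg_UNIV)
qed

lemma homogeneous_const_mult:
  fixes p :: "('v::finite, 'a::comm_ring_1) mpoly"
  shows "homogeneous a p \<Longrightarrow> homogeneous a (const c * p)"
  using homogeneous_mult[OF homogeneous_const] by simp

lemma homogeneous_power:
  fixes p :: "('v::finite, 'a::comm_ring_1) mpoly"
  assumes "homogeneous a p"
  shows "homogeneous (a * n) (p ^ n)"
proof (induction n)
  case 0
  show ?case using homogeneous_const[of "1 :: 'a"] by simp
next
  case (Suc n)
  show ?case using homogeneous_mult[OF assms Suc] by (simp add: add.commute)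
qed

section \<open>Specializing lambda in the coefficients\<close>

definition coeff_eval ::
    "complex \<Rightarrow> ('v, complex poly) mpoly \<Rightarrow> ('v, complex) mpoly" where
  "coeff_eval z p = Poly_Mapping.map (\<lambda>c. poly c z) p"

lemma lookup_coeff_eval: "Poly_Mapping.lookup (coeff_eval z p) \<alpha>
    = poly (Poly_Mapping.lookup p \<alpha>) z"
  by (simp add: coeff_eval_def Poly_Mapping.map.rep_eq when_def)

lemma coeff_eval_single: "coeff_eval z (Poly_Mapping.single \<alpha> c)
    = Poly_Mapping.single \<alpha> (poly c z)"
  by (rule poly_mapping_eqI) (simp add: lookup_coeff_eval lookup_single when_def)

lemma coeff_eval_add: "coeff_eval z (p + q) = coeff_eval z p + coeff_eval z q"
  by (rule poly_mapping_eqI) (simp add: lookup_coeff_eval lookup_add)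

lemma coeff_eval_diff: "coeff_eval z (p - q) = coeff_eval z p - coeff_eval z q"
  by (rule poly_mapping_eqI) (simp add: lookup_coeff_eval lookup_minus)

lemma coeff_eval_sum: "coeff_eval z (sum f I) = (\<Sum>i\<in>I. coeff_eval z (f i))"
  by (rule poly_mapping_eqI) (simp add: lookup_coeff_eval lookup_sum poly_sum)

lemma coeff_eval_mult:
  fixes p q :: "('v::finite, complex poly) mpoly"
  shows "coeff_eval z (p * q) = coeff_eval z p * coeff_eval z q"
proof -
  have single: "coeff_eval z r
      = (\<Sum>\<mu>\<in>Poly_Mapping.keys r. Poly_Mapping.single \<mu> (poly (Poly_Mapping.lookup r
          \<mu>) z))"
    for r :: "('v, complex poly) mpoly"
    by (subst mpoly_sum_single) (simp add: coeff_eval_sum coeff_eval_single)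
  have "coeff_eval z (p * q) = coeff_eval z
     ((\<Sum>\<mu>\<in>Poly_Mapping.keys p. Poly_Mapping.single \<mu> (Poly_Mapping.lookup p \<mu>)) *
      (\<Sum>\<mu>\<in>Poly_Mapping.keys q. Poly_Mapping.single \<mu> (Poly_Mapping.lookup q \<mu>)))"
    by (simp flip: mpoly_sum_single)
  also have "\<dots> = coeff_eval z p * coeff_eval z q"
    by (simp add: sum_product mult_single coeff_eval_sum coeff_eval_single single)
  finally show ?thesis .
qed

lemma coeff_eval_const [simp]: "coeff_eval z (const c) = const (poly c z)"
  by (simp add: const_def coeff_eval_single)

lemma coeff_eval_one [simp]: "coeff_eval z 1 = 1"
  using coeff_eval_const[of z 1] by simp

lemma coeff_eval_var [simp]: "coeff_eval z (var v) = var v"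
  by (simp add: var_def coeff_eval_single)

lemma coeff_eval_power:
  "coeff_eval z (p ^ n :: ('v::finite, complex poly) mpoly) = coeff_eval z p ^ n"
  by (induction n) (simp_all add: coeff_eval_mult)

lemma coeff_eval_prod_list:
  "coeff_eval z (prod_list ps :: ('v::finite, complex poly) mpoly) = prod_list (map (coeff_eval z) ps)"
  by (induction ps) (simp_all add: coeff_eval_mult)

lemmas coeff_eval_simps = coeff_eval_add coeff_eval_diff coeff_eval_sum coeff_eval_mult
  coeff_eval_power coeff_eval_prod_list

section \<open>Evaluating the multipolynomial resultant\<close>

text \<open>Evaluation at \<open>z\<close> is a ring homomorphism on the coefficients. The
  E-characteristic polynomial can thus be studied as a complex resultant at each value of
  lambda.\<close>

lemma poly_res_at:
  "poly (res_at (\<lambda>c. [:c:]) R F) z = res_at id R (\<lambda>i. coeff_eval z (F i))"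
  by (simp add: res_at_def meval_def poly_sum poly_prod lookup_coeff_eval case_prod_unfold)

lemma bipoly_res_at:
  assumes "\<And>i \<alpha>. bipoly (\<lambda>x y. Poly_Mapping.lookup (F x y i) \<alpha>)"
  shows "bipoly (\<lambda>x y. res_at id R (F x y))"
  unfolding res_at_def meval_def case_prod_unfold by (intro bipoly_intros assms)

text \<open>Every monomial of \<open>R\<close> has the prescribed total degree in the coefficients
  of the form with index \<open>i\<close>, so every term acquires the same power of
  \<open>c\<close>.\<close>

lemma res_at_scale:
  assumes "is_resultant d R"
  shows "res_at id R (F(i := const c * F i)) = c ^ (\<Prod>j\<in>UNIV - {i}. d j) * res_at id R F"
proof -
  let ?D = "\<Prod>j\<in>UNIV - {i}. d j"
  have "(\<Prod>(k, \<alpha>)\<in>Poly_Mapping.keys \<mu>.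
        Poly_Mapping.lookup ((F(i := const c
            * F i)) k) \<alpha> ^ Poly_Mapping.lookup \<mu> (k, \<alpha>))
      = c ^ ?D * (\<Prod>(k, \<alpha>)\<in>Poly_Mapping.keys \<mu>. Poly_Mapping.lookup (F k) \<alpha>
          ^ Poly_Mapping.lookup \<mu> (k, \<alpha>))"
    if "\<mu> \<in> Poly_Mapping.keys R" for \<mu>
  proof -
    have sumD: "(\<Sum>v\<in>{v \<in> Poly_Mapping.keys \<mu>. fst v = i}. Poly_Mapping.lookup \<mu> v)
        = ?D"
      using assms that by (simp add: is_resultant_def case_prod_unfold)
    have "(\<Prod>(k, \<alpha>)\<in>Poly_Mapping.keys \<mu>.
        Poly_Mapping.lookup ((F(i := const c
            * F i)) k) \<alpha> ^ Poly_Mapping.lookup \<mu> (k, \<alpha>))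
      = (\<Prod>v\<in>Poly_Mapping.keys \<mu>. (if fst v
          = i then c ^ Poly_Mapping.lookup \<mu> v else 1) *
          Poly_Mapping.lookup (F (fst v)) (snd v) ^ Poly_Mapping.lookup \<mu> v)"
      by (rule prod.cong) (auto simp: lookup_const_mult power_mult_distrib)
    also have "\<dots> = (\<Prod>v\<in>{v \<in> Poly_Mapping.keys \<mu>. fst v
        = i}. c ^ Poly_Mapping.lookup \<mu> v) *
        (\<Prod>(k, \<alpha>)\<in>Poly_Mapping.keys \<mu>. Poly_Mapping.lookup (F k) \<alpha> ^
            Poly_Mapping.lookup \<mu> (k, \<alpha>))"
      by (simp add: prod.distrib prod.inter_filter case_prod_unfold)
    also have "(\<Prod>v\<in>{v \<in> Poly_Mapping.keys \<mu>. fst v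
        = i}. c ^ Poly_Mapping.lookup \<mu> v) = c ^ ?D"
      unfolding sumD[symmetric] by (simp add: power_sum)
    finally show ?thesis .
  qed
  then show ?thesis
    unfolding res_at_def meval_def sum_distrib_left
    by (intro sum.cong) (simp_all add: case_prod_unfold)
qed

lemma res_at_zero_iff:
  assumes "is_resultant d R" "\<And>i. homogeneous (d i) (F i)"
  shows "res_at id R F = 0 \<longleftrightarrow> (\<exists>x. (\<exists>i. x i \<noteq> 0)
      \<and> (\<forall>i. meval id x (F i) = 0))"
  using assms unfolding is_resultant_def by blast

text \<open>The linear extension of \<open>X ^ k \<mapsto> e k\<close> up to exponent
  \<open>N\<close>, carrying univariate polynomials to forms; it need not respect products.\<close>

definition combination ::
    "nat \<Rightarrow> (nat \<Rightarrow> ('v, complex) mpoly) \<Rightarrow> complex poly \<Rightarrow>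
        ('v, complex) mpoly" where
  "combination N e f = (\<Sum>k\<le>N. const (poly.coeff f k) * e k)"

lemma lookup_combination:
  "Poly_Mapping.lookup (combination N e f) \<alpha> = (\<Sum>k\<le>N. poly.coeff f k
      * Poly_Mapping.lookup (e k) \<alpha>)"
  by (simp add: combination_def lookup_sum lookup_const_mult)

lemma combination_add: "combination N e (f + g) = combination N e f + combination N e g"
  by (simp add: combination_def const_add algebra_simps sum.distrib)

lemma combination_diff: "combination N e (f - g) = combination N e f - combination N e g"
  by (simp add: combination_def const_diff algebra_simps sum_subtractf)

lemma combination_smult: "combination N e (smult c f) = const c * combination N e f"
  by (simp add: combination_def const_mult sum_distrib_left ac_simps)

lemma combination_sum: "combination N e (sum f I) = (\<Sum>i\<in>I. combination N e (f i))"
  by (induction I rule: infinite_finite_induct) (simp_all add: combination_add, simp_all add: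
      combination_def)

lemma combination_monom:
  assumes "j \<le> N"
  shows "combination N e (monom c j) = const c * e j"
proof -
  have "combination N e (monom c j) = (\<Sum>k\<le>N. if k = j then const c * e k else 0)"
    unfolding combination_def by (rule sum.cong) auto
  then show ?thesis using assms by simp
qed

lemma homogeneous_combination:
  fixes e :: "nat \<Rightarrow> ('v::finite, complex) mpoly"
  assumes "\<And>k. k \<le> N \<Longrightarrow> homogeneous n (e k)"
  shows "homogeneous n (combination N e f)"
  unfolding combination_def by (intro homogeneous_sum homogeneous_const_mult) (use assms in auto)

lemma poly_eq_sum:
  fixes h :: "'a::comm_semiring_1 poly"
  assumes "degree h \<le> N"
  shows "poly h s = (\<Sum>k\<le>N. poly.coeff h k * s ^ k)"
  unfolding poly_altdef
      by (rule sum.mono_neutral_left) (use assms in \<open>auto simp: coeff_eq_0\<close>)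

text \<open>If the common zeros of the forms other than those with indices \<open>i\<close> and
    \<open>j\<close> make up a
  rational curve on which \<open>e k\<close> restricts to \<open>s ^ k\<close>, the resultant of
      combinations of the \<open>e k\<close>
  is a resultant of binary forms.\<close>

lemma binary_resultant_on_curve:
  fixes e :: "nat \<Rightarrow> ('v::finite, complex) mpoly"
  assumes R: "is_resultant d R" and ij: "i \<noteq> j" "d i = n" "d j = n"
    and N: "(\<Prod>k\<in>UNIV - {i}. d k) = N" "(\<Prod>k\<in>UNIV - {j}. d k) = N" "N > 0"
    and F: "\<And>k. k \<noteq> i \<Longrightarrow> k \<noteq> j
        \<Longrightarrow> homogeneous (d k) (F k)"
    and e: "\<And>k. k \<le> N \<Longrightarrow> homogeneous n (e k)"
    and curve: "\<And>x. (\<exists>k. x k \<noteq> 0) \<Longrightarrow> (\<And>k. k \<noteq> i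
        \<Longrightarrow> k \<noteq> j \<Longrightarrow> meval id x (F k) = 0) \<Longrightarrow>
      (\<exists>c s. c \<noteq> 0 \<and> (\<forall>k\<le>N. meval id x (e k) = c * s ^ k)) \<or>
      (\<exists>c. c \<noteq> 0 \<and> (\<forall>k\<le>N. meval id x (e k) = (if k = N then c else 0)))"
    and finite_point: "\<And>s. \<exists>x. (\<exists>k. x k \<noteq> 0)
        \<and> (\<forall>k. k \<noteq> i \<longrightarrow> k \<noteq> j
            \<longrightarrow> meval id x (F k) = 0) \<and>
      (\<forall>k\<le>N. meval id x (e k) = s ^ k)"
    and infinite_point: "\<exists>x. (\<exists>k. x k \<noteq> 0) \<and> (\<forall>k. k \<noteq> i
        \<longrightarrow> k \<noteq> j \<longrightarrow> meval id x (F k) = 0) \<and>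
      (\<forall>k\<le>N. meval id x (e k) = (if k = N then 1 else 0))"
  shows "binary_resultant N
    (\<lambda>f g. res_at id R (F(i := combination N e f, j := combination N e g)))"
proof
  show "N > 0" by fact
next
  fix f g :: "complex \<Rightarrow> complex \<Rightarrow> complex poly"
  assume "\<And>k. bipoly (\<lambda>x y. poly.coeff (f x y) k)"
      "\<And>k. bipoly (\<lambda>x y. poly.coeff (g x y) k)"
  note fg = this
  show "bipoly (\<lambda>x y. res_at id R (F(i := combination N e (f x y), j := combination N e (g x
      y))))"
  proof (rule bipoly_res_at)
    fix k \<alpha>
    have "bipoly (\<lambda>x y. Poly_Mapping.lookup (combination N e (f x y)) \<alpha>)"
      "bipoly (\<lambda>x y. Poly_Mapping.lookup (combination N e (g x y)) \<alpha>)"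
      unfolding lookup_combination by (intro bipoly_intros fg)+
    then show "bipoly (\<lambda>x y. Poly_Mapping.lookup
        ((F(i := combination N e (f x y), j := combination N e (g x y))) k) \<alpha>)"
      by (cases "k = j"; cases "k = i") (simp_all add: bipoly_const)
  qed
next
  fix a f g
  have "F(i := combination N e (smult a f), j := combination N e g)
     = (F(i := combination N e f, j := combination N e g))
       (i := const a * (F(i := combination N e f, j := combination N e g)) i)"
    using ij by (auto simp: combination_smult)
  then show "res_at id R (F(i := combination N e (smult a f), j := combination N e g))
     = a ^ N * res_at id R (F(i := combination N e f, j := combination N e g))"
    by (simp only: res_at_scale[OF R] N)
  have "F(i := combination N e f, j := combination N e (smult a g))
     = (F(i := combination N e f, j := combination N e g))
       (j := const a * (F(i := combination N e f, j := combination N e g)) j)"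
    using ij by (auto simp: combination_smult)
  then show "res_at id R (F(i := combination N e f, j := combination N e (smult a g)))
     = a ^ N * res_at id R (F(i := combination N e f, j := combination N e g))"
    by (simp only: res_at_scale[OF R] N)
next
  fix f g :: "complex poly" assume deg: "degree f \<le> N" "degree g \<le> N"
  let ?G = "F(i := combination N e f, j := combination N e g)"
  have eval: "meval id x (combination N e h) = (\<Sum>k\<le>N. poly.coeff h k * meval id x (e k))"
      for x h
    by (simp add: combination_def meval_simps)
  \<comment> \<open>Up to a nonzero scalar, a combination takes the value \<open>h(s)\<close> at a
    finite point of the curve and its coefficient at \<open>N\<close> at the infinite one. This
    matches the two alternatives for a common zero.\<close>
  have finite_eval: "meval id x (combination N e h) = c * poly h s"
    if "\<forall>k\<le>N. meval id x (e k) = c * s ^ k" "degree h \<le> N" for x h c s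
    using that by (simp add: eval poly_eq_sum[OF that(2)] sum_distrib_left ac_simps)
  have infinite_eval: "meval id x (combination N e h) = poly.coeff h N * c"
    if "\<forall>k\<le>N. meval id x (e k) = (if k = N then c else 0)" for x h c
  proof -
    have "meval id x (combination N e h) = (\<Sum>k\<le>N. if k = N then poly.coeff h k * c else 0)"
      unfolding eval by (rule sum.cong) (use that in auto)
    then show ?thesis by simp
  qed
  have hom: "homogeneous (d k) (?G k)" for k
    using F e ij by (auto intro!: homogeneous_combination)
  have "res_at id R ?G = 0 \<longleftrightarrow> (\<exists>x. (\<exists>k. x k \<noteq> 0)
      \<and> (\<forall>k. meval id x (?G k) = 0))"
    by (rule res_at_zero_iff[OF R hom])
  also have "\<dots> \<longleftrightarrow> (\<exists>s. poly f s = 0 \<and> poly g s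
      = 0) \<or> (poly.coeff f N = 0 \<and> poly.coeff g N = 0)"
  proof
    assume "\<exists>x. (\<exists>k. x k \<noteq> 0) \<and> (\<forall>k. meval id x (?G k) = 0)"
    then obtain x where x: "\<exists>k. x k \<noteq> 0" "\<And>k. meval id x (?G k) = 0" by blast
    have 1: "meval id x (combination N e f) = 0" "meval id x (combination N e g) = 0"
      using x(2)[of i] x(2)[of j] ij by auto
    have "meval id x (F k) = 0" if "k \<noteq> i" "k \<noteq> j" for k using x(2)[of k] that by simp
    from curve[OF x(1) this] show "(\<exists>s. poly f s = 0 \<and> poly g s = 0) \<or> (poly.coeff f N
        = 0 \<and> poly.coeff g N = 0)"
      using 1 finite_eval[of x _ _ f] finite_eval[of x _ _ g] infinite_eval[of x _ f]
        infinite_eval[of x _ g] deg by (metis mult_eq_0_iff)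
  next
    assume "(\<exists>s. poly f s = 0 \<and> poly g s = 0) \<or> (poly.coeff f N = 0
        \<and> poly.coeff g N = 0)"
    then show "\<exists>x. (\<exists>k. x k \<noteq> 0) \<and> (\<forall>k. meval id x (?G k) = 0)"
    proof
      assume "\<exists>s. poly f s = 0 \<and> poly g s = 0"
      then obtain s where s: "poly f s = 0" "poly g s = 0" by blast
      obtain x where x: "\<exists>k. x k \<noteq> 0" "\<And>k. k \<noteq> i
          \<Longrightarrow> k \<noteq> j \<Longrightarrow> meval id x (F k) = 0"
        "\<forall>k\<le>N. meval id x (e k) = 1 * s ^ k" using finite_point[of s] by auto
      show ?thesis
        by (rule exI[of _ x]) (use x s finite_eval[OF x(3)] deg in auto)
    next
      assume s: "poly.coeff f N = 0 \<and> poly.coeff g N = 0"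
      obtain x where x: "\<exists>k. x k \<noteq> 0" "\<And>k. k \<noteq> i
          \<Longrightarrow> k \<noteq> j \<Longrightarrow> meval id x (F k) = 0"
        "\<forall>k\<le>N. meval id x (e k) = (if k = N then 1 else 0)" using infinite_point by auto
      show ?thesis
        by (rule exI[of _ x]) (use x s infinite_eval[OF x(3)] in auto)
    qed
  qed
  finally show "res_at id R ?G = 0 \<longleftrightarrow>
      (\<exists>s. poly f s = 0 \<and> poly g s = 0) \<or> (poly.coeff f N = 0 \<and> poly.coeff g N
          = 0)" .
qed

section \<open>The leading coefficient on a rational curve\<close>

text \<open>For degree at most \<open>n\<close> this is the substitution
  \<open>X \<mapsto> X ^ c\<close>; odd order needs \<open>c = 2\<close>, since there
  \<open>u = s ^ 2\<close>. The explicit sum matches \<open>homogenize\<close> term by term.\<close>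

definition stretch :: "nat \<Rightarrow> nat \<Rightarrow> complex poly \<Rightarrow> complex poly" where
  "stretch c n f = (\<Sum>k\<le>n. monom (poly.coeff f k) (c * k))"

lemma degree_stretch: "degree (stretch c n f) \<le> c * n"
  unfolding stretch_def
  by (intro degree_sum_le) (auto intro: order.trans[OF degree_monom_le])

lemma coeff_stretch_top:
  assumes "c \<ge> 1"
  shows "poly.coeff (stretch c n f) (c * n) = poly.coeff f n"
proof -
  have "poly.coeff (stretch c n f) (c * n) = (\<Sum>k\<le>n. if k = n then poly.coeff f k else 0)"
    unfolding stretch_def coeff_sum by (rule sum.cong) (use assms in auto)
  then show ?thesis by simp
qed

lemma poly_stretch: "degree f \<le> n \<Longrightarrow> poly (stretch c n f) s = poly f (s ^ c)"
  by (simp add: stretch_def poly_sum poly_monom poly_eq_sum power_mult)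

lemma stretch_add: "stretch c n (f + g) = stretch c n f + stretch c n g"
  by (simp add: stretch_def add_monom[symmetric] sum.distrib)

lemma stretch_smult: "stretch c n (smult a f) = smult a (stretch c n f)"
  by (rule poly_eqI) (simp add: stretch_def coeff_sum sum_distrib_left, rule sum.cong, auto)

lemma stretch_diff: "stretch c n (f - g) = stretch c n f - stretch c n g"
  using stretch_add[of c n f "- g"] stretch_smult[of c n "-1" g] by simp

context binary_resultant
begin

text \<open>The two arguments in \<open>norm\<close> are the powers of \<open>x_1\<close> and
  \<open>x_2\<close> in isotropic coordinates. Up to scalars they are \<open>A\<close> and
  \<open>B\<close>, and \<open>B\<close> is constant on the roots of \<open>A\<close>, so it can be
  deformed to a constant form.\<close>

lemma K_eq_if_normalized:
  assumes N: "N = c * n" and c: "c \<ge> 1"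
    and norm: "Phi (stretch c n ([:1/2, 1/2:] ^ n)) (stretch c n ([:\<i>/2, -\<i>/2:] ^ n)) = 1"
  shows "K = (- 2 * \<i>) ^ (n * N)"
proof -
  define A where "A = stretch c n ([:1, 1:] ^ n)"
  define B where "B = stretch c n ([:-1, 1:] ^ n)"
  define C :: "complex poly" where "C = [:(-2) ^ n:]"
  have dp: "degree ([:a, b:] ^ n) \<le> n" for a b :: complex
    using degree_power_le[of "[:a, b:]" n] by (auto split: if_splits)
  have degs: "degree A \<le> N" "degree B \<le> N"
    using degree_stretch N by (auto simp: A_def B_def)
  have "lead_coeff ([:1, 1:] ^ n :: complex poly) = 1" by (simp add: lead_coeff_power)
  moreover have "degree ([:1, 1:] ^ n :: complex poly) = n" by (simp add: degree_power_eq)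
  ultimately have leadA: "poly.coeff A N = 1"
    using c by (simp add: A_def N coeff_stretch_top)
  have "Phi (A + smult t 0) (B + smult t (C - B)) \<noteq> 0" for t
  proof -
    have "degree (B + smult t (C - B)) \<le> N"
      using degs by (intro degree_add_le order.trans[OF degree_smult_le] degree_diff_le) (auto simp:
          C_def)
    \<comment> \<open>A root of \<open>A\<close> has \<open>s ^ c = -1\<close>, where
      \<open>B\<close> and \<open>C\<close> both equal \<open>(-2) ^ n\<close>; the value on the
      whole line of forms is therefore this nonzero number.\<close>
    moreover have "poly (B + smult t (C - B)) s \<noteq> 0" if "poly A s = 0" for s
    proof -
      have n: "n > 0" using N N_pos by (cases n) auto
      have "(1 + s ^ c) ^ n = 0" using that by (simp add: A_def poly_stretch[OF dp] poly_power)
      then have "s ^ c = -1" by (simp add: add_eq_0_iff)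
      then have "poly B s = (-2) ^ n" by (simp add: B_def poly_stretch[OF dp] poly_power)
      then show ?thesis by (simp add: C_def)
    qed
    ultimately show ?thesis using degs leadA by (subst Phi_eq_0_iff) auto
  qed
  from Phi_deform[OF this] have "Phi A B = Phi A C" by simp
  also have "C = smult ((-2) ^ n) 1" by (simp add: C_def)
  also have "Phi A \<dots> = (-2) ^ (n * N) * K"
    unfolding Phi_smult_right power_mult using Phi_monic_one[of A] degs leadA by simp
  finally have AB: "Phi A B = (-2) ^ (n * N) * K" .
  have "[:1/2, 1/2:] = smult (1/2) [:1, 1 :: complex:]" "[:\<i>/2, -\<i>/2:] = smult (-\<i>/2) [:-1, 1:]"
    by simp_all
  then have "1 = Phi (stretch c n (smult (1/2) [:1, 1:] ^ n)) (stretch c n (smult (-\<i>/2) [:-1, 1:] ^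
      n))"
    using norm by (simp only:)
  also have "\<dots> = (1/2) ^ (n * N) * ((-\<i>/2) ^ (n * N) * Phi A B)"
    unfolding smult_power stretch_smult Phi_smult_left Phi_smult_right
    by (simp only: A_def B_def power_mult mult.left_commute)
  also have "\<dots> = ((1/2) * (-\<i>/2) * (-2)) ^ (n * N) * K"
    unfolding AB power_mult_distrib by (simp only: mult_ac)
  finally have "1 = (\<i>/2) ^ (n * N) * K" by simp
  \<comment> \<open>\<open>- 2 * \<i>\<close> is the inverse of \<open>\<i> / 2\<close>.\<close>
  then have "(- 2 * \<i>) ^ (n * N) = ((- 2 * \<i>) * (\<i>/2)) ^ (n * N) * K"
    unfolding power_mult_distrib by (simp only: mult.assoc mult_1_right)
  then show ?thesis by simp
qed

text \<open>The subtracted terms are \<open>w x_1\<close> and \<open>w x_2\<close> in isotropic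
  coordinates. Rotating the pair to \<open>T1 + \<i> T2\<close> and \<open>T1 - \<i> T2\<close>
  turns them into the single monomials \<open>X ^ M\<close> and \<open>X ^ (M - c)\<close>, at the
  cost of the factor \<open>(- 2 * \<i>) ^ N\<close>.\<close>

lemma coeff_lambda_pencil:
  assumes N: "N = c * n" and c: "1 \<le> c" "c \<le> M" "N + c = 2 * M"
    and T: "degree T1 \<le> n" "degree T2 \<le> n"
    and psi: "\<And>l. poly psi l = Phi
      (stretch c n T1 - smult l (smult (1/2) (monom 1 M + monom 1 (M - c))))
      (stretch c n T2 - smult l (smult (-\<i>/2) (monom 1 M - monom 1 (M - c))))"
  shows "j > 2 * M \<Longrightarrow> poly.coeff psi j = 0"
    and "(- 2 * \<i>) ^ N * poly.coeff psi (2 * M) = K * (-1) ^ (c + M) *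
      (poly.coeff (T1 - smult \<i> T2) n * poly (T1 + smult \<i> T2) 0) ^ (M - c)"
proof -
  define P1 where "P1 = stretch c n (T1 + smult \<i> T2)"
  define P2 where "P2 = stretch c n (T1 - smult \<i> T2)"
  have deg: "degree P1 \<le> N" "degree P2 \<le> N"
    using degree_stretch N by (auto simp: P1_def P2_def)
  have MN: "M \<le> N" using c by simp
  have "poly (smult ((- 2 * \<i>) ^ N) psi) l
    = Phi (P1 - smult l (monom 1 M)) (P2 - smult l (monom 1 (M - c)))" for l
  proof -
    define f where "f = stretch c n T1 - smult l (smult (1/2) (monom 1 M + monom 1 (M - c)))"
    define g where "g = stretch c n T2 - smult l (smult (-\<i>/2) (monom 1 M - monom 1 (M - c)))"
    have d: "degree f \<le> N" "degree g \<le> N"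
      unfolding f_def g_def using MN N
      by (intro degree_diff_le degree_add_le order.trans[OF degree_smult_le]
          order.trans[OF degree_monom_le] order.trans[OF degree_stretch]; simp)+
    have "f + smult \<i> g = P1 - smult l (monom 1 M)"
      unfolding f_def g_def P1_def stretch_add stretch_smult
      by (rule poly_eqI) (simp add: algebra_simps)
    moreover have "f - smult \<i> g = P2 - smult l (monom 1 (M - c))"
      unfolding f_def g_def P2_def stretch_diff stretch_smult
      by (rule poly_eqI) (simp add: algebra_simps)
    ultimately show ?thesis
      using Phi_rotate[OF d] by (simp add: psi f_def g_def)
  qed
  note lam = Phi_lambda[OF c deg this]
  have T': "degree (T1 + smult \<i> T2) \<le> n"
    using T by (intro degree_add_le order.trans[OF degree_smult_le])
  show "poly.coeff psi j = 0" if "j > 2 * M"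
    using lam(1)[OF that] by simp
  have "poly.coeff P2 N = poly.coeff (T1 - smult \<i> T2) n"
    unfolding P2_def N by (rule coeff_stretch_top[OF c(1)])
  moreover have "poly P1 0 = poly (T1 + smult \<i> T2) 0"
    unfolding P1_def poly_stretch[OF T'] using c by (simp add: zero_power)
  ultimately show "(- 2 * \<i>) ^ N * poly.coeff psi (2 * M) = K * (-1) ^ (c + M) *
      (poly.coeff (T1 - smult \<i> T2) n * poly (T1 + smult \<i> T2) 0) ^ (M - c)"
    using lam(2) by (simp only: coeff_smult)
qed

end

section \<open>The tensor in isotropic coordinates\<close>

text \<open>With \<open>u = x\<^sub>1 + \<i> x\<^sub>2\<close>, \<open>v = x\<^sub>1
    - \<i> x\<^sub>2\<close> and \<open>v\<close> set to 1, the coordinates are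
  \<open>x\<^sub>1 = (u + 1) / 2\<close> and \<open>x\<^sub>2 = (u - 1) / (2 \<i>)\<close>.\<close>

definition isotropic :: "2 \<Rightarrow> complex poly" where
  "isotropic i = (if i = 1 then [:1/2, 1/2:] else [:\<i>/2, -\<i>/2:])"

definition tensor_poly ::
    "nat \<Rightarrow> (2 list \<Rightarrow> complex) \<Rightarrow> 2 \<Rightarrow> complex poly" where
  "tensor_poly m A i = tensor_apply m (\<lambda>is. [:A is:]) isotropic i"

section \<open>Homogenization of products of linear factors\<close>

definition homogenize ::
    "nat \<Rightarrow> ('v, complex) mpoly \<Rightarrow> ('v, complex) mpoly \<Rightarrow> complex poly
        \<Rightarrow> ('v, complex) mpoly" where
  "homogenize n u v f = (\<Sum>k\<le>n. const (poly.coeff f k) * (u ^ k * v ^ (n - k)))"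

lemma homogenize_add: "homogenize n u v (f + g) = homogenize n u v f + homogenize n u v g"
  by (simp add: homogenize_def const_add algebra_simps sum.distrib)

lemma homogenize_smult: "homogenize n u v (smult c f) = const c * homogenize n u v f"
  by (simp add: homogenize_def const_mult sum_distrib_left ac_simps)

lemma homogenize_sum: "homogenize n u v (sum f I) = (\<Sum>i\<in>I. homogenize n u v (f i))"
  by (induction I rule: infinite_finite_induct) (simp_all add: homogenize_add, simp_all add:
      homogenize_def)

lemma homogenize_linear_mult:
  assumes "degree f \<le> n"
  shows "homogenize (Suc n) u v ([:b, a:] * f) = (const a * u + const b * v) * homogenize n u v f"
proof -
  have "poly.coeff f (Suc n) = 0" using assms by (intro coeff_eq_0) simp
  then have 1: "homogenize (Suc n) u v f = v * homogenize n u v f"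
    by (simp add: homogenize_def sum_distrib_left Suc_diff_le algebra_simps)
  have 2: "homogenize (Suc n) u v (pCons 0 f) = u * homogenize n u v f"
    unfolding homogenize_def sum.atMost_Suc_shift
    by (simp add: sum_distrib_left ac_simps)
  have "[:b, a:] * f = smult b f + smult a (pCons 0 f)" by simp
  then show ?thesis
    by (simp only: homogenize_add homogenize_smult 1 2) (simp add: algebra_simps)
qed

lemma degree_prod_list_linear: "degree (prod_list (map (\<lambda>j. [:b j, a j:]) xs)) \<le> length xs"
proof (induction xs)
  case (Cons x xs)
  have "degree ([:b x, a x:] * prod_list (map (\<lambda>j. [:b j, a j:]) xs))
     \<le> degree [:b x, a x:] + degree (prod_list (map (\<lambda>j. [:b j, a j:]) xs))"
    by (rule degree_mult_le)
  also have "degree [:b x, a x:] \<le> 1" by simp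
  finally show ?case using Cons by simp
qed simp

lemma coeff_prod_list_linear:
  fixes a b :: "'b \<Rightarrow> 'a::comm_ring_1"
  shows "poly.coeff (prod_list (map (\<lambda>j. [:b j, a j:]) xs)) (length xs) = prod_list (map a xs)"
proof (induction xs)
  case (Cons x xs)
  have "poly.coeff (prod_list (map (\<lambda>j. [:b j, a j:]) xs)) (Suc (length xs)) = 0"
    using degree_prod_list_linear[of b a xs] by (intro coeff_eq_0) simp
  then show ?case using Cons by simp
qed simp

lemma homogenize_prod_list_linear:
  "homogenize (length xs) u v (prod_list (map (\<lambda>j. [:b j, a j:]) xs))
    = prod_list (map (\<lambda>j. const (a j) * u + const (b j) * v) xs)"
proof (induction xs)
  case Nil
  show ?case by (simp add: homogenize_def)
next
  case (Cons x xs)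
  show ?case
    using homogenize_linear_mult[OF degree_prod_list_linear[of b a xs], of u v "b x" "a x"] Cons
    by (simp del: mult_pCons_left)
qed

lemma isotropic_eq: "isotropic = (\<lambda>i. [:if i = 1 then 1/2 else \<i>/2, if i
    = 1 then 1/2 else -\<i>/2:])"
  by (auto simp: isotropic_def)

lemma finite_index_lists: "finite {is :: 2 list. length is = n}"
  using finite_lists_length_eq[of "UNIV :: 2 set" n] by simp

lemma degree_tensor_poly: "degree (tensor_poly m A i) \<le> m - 1"
proof -
  have "degree ([:A (i # is):] * prod_list (map isotropic is)) \<le> m - 1" if "length is = m - 1" for
      "is"
  proof -
    have "degree (prod_list (map isotropic is)) \<le> length is"
      unfolding isotropic_eq by (rule degree_prod_list_linear)
    then show ?thesis
      using degree_mult_le[of "[:A (i # is):]" "prod_list (map isotropic is)"] that by simp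
  qed
  then show ?thesis
    unfolding tensor_poly_def tensor_apply_def
    by (intro degree_sum_le finite_index_lists) blast
qed

text \<open>Setting \<open>v = 1\<close> loses nothing: each tensor entry multiplies exactly
  \<open>m - 1\<close> linear factors, and homogenizing in that degree restores each factor.\<close>

lemma homogenize_tensor_poly:
  fixes y :: "2 \<Rightarrow> ('v, complex) mpoly"
  assumes "y 1 = const (1/2) * u + const (1/2) * v" "y 2 = const (-\<i>/2) * u + const (\<i>/2) * v"
  shows "homogenize (m - 1) u v (tensor_poly m A i) = tensor_apply m (\<lambda>is. const (A is)) y i"
proof -
  have y: "const (if i = 1 then 1/2 else -\<i>/2) * u + const (if i = 1 then 1/2 else \<i>/2) * v
      = y i" for i
    using assms exhaust_2[of i] by auto
  have "homogenize (m - 1) u v ([:A (i # is):] * prod_list (map isotropic is))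
     = const (A (i # is)) * prod_list (map y is)" if "length is = m - 1" for "is"
    using homogenize_prod_list_linear[of "is" u v "\<lambda>i. if i = 1 then 1/2 else \<i>/2"
        "\<lambda>i. if i = 1 then 1/2 else -\<i>/2"]
    unfolding isotropic_eq y that by (simp add: homogenize_smult)
  then show ?thesis
    unfolding tensor_poly_def tensor_apply_def homogenize_sum by (intro sum.cong) simp_all
qed

section \<open>The alternating sums as tensor values at isotropic points\<close>

lemma prod_list_two_valued:
  "prod_list (map (\<lambda>j :: 2. if j = 1 then a else a * t) xs) = a ^ length xs
      * t ^ count_list xs 2"
  for a t :: "'a::comm_ring_1"
proof (induction xs)
  case (Cons x xs)
  then show ?case using exhaust_2[of x] by (auto simp: algebra_simps)
qed simp

lemma count_list_le_length: "count_list xs x \<le> length xs"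
  by (induction xs) auto

lemma sum_by_count:
  fixes A :: "2 list \<Rightarrow> complex"
  assumes "m \<ge> 1"
  shows "(\<Sum>is | length is = m - 1. A (i # is) * t ^ count_list is (2 :: 2))
    = (\<Sum>j = 1..m. t ^ (j - 1) * (\<Sum>is | length is = m - 1 \<and> count_list is 2 = j
        - 1. A (i # is)))"
proof -
  have range: "(\<lambda>is. count_list is (2 :: 2) + 1) ` {is. length is = m - 1} \<subseteq> {1..m}"
  proof safe
    fix xs :: "2 list" assume "length xs = m - 1"
    then show "count_list xs 2 + 1 \<in> {1..m}"
      using count_list_le_length[of xs 2] assms by auto
  qed
  have "(\<Sum>is | length is = m - 1. A (i # is) * t ^ count_list is (2 :: 2))
    = (\<Sum>j = 1..m. \<Sum>is\<in>{is \<in> {is. length is = m - 1}. count_list is 2 + 1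
        = j}. A (i # is) * t ^ count_list is 2)"
    by (rule sum.group[OF finite_index_lists finite_atLeastAtMost range, symmetric])
  also have "\<dots> = (\<Sum>j = 1..m. t ^ (j - 1) * (\<Sum>is | length is = m - 1
      \<and> count_list is 2 = j - 1. A (i # is)))"
  proof (rule sum.cong)
    fix j assume "j \<in> {1..m}"
    then have "{is \<in> {is :: 2 list. length is = m - 1}. count_list is 2 + 1 = j}
       = {is. length is = m - 1 \<and> count_list is 2 = j - 1}" by auto
    then show "(\<Sum>is\<in>{is \<in> {is. length is = m - 1}. count_list is 2 + 1 = j}. A (i # is)
        * t ^ count_list is 2)
       = t ^ (j - 1) * (\<Sum>is | length is = m - 1 \<and> count_list is 2 = j - 1. A (i # is))"
      by (simp add: sum_distrib_left mult.commute)
  qed simp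
  finally show ?thesis .
qed

text \<open>For \<open>t\<close> equal to \<open>\<i>\<close> or \<open>-\<i>\<close> the powers run
  through \<open>1, t, -1, -t\<close>. This cycle produces both the signs of period four and the
  alternation of \<open>b\<close> and \<open>c\<close>.\<close>

lemma P_Q_sum_eq:
  assumes "m \<ge> 1" "t ^ 2 = -1"
  shows "P_sum m A + t * Q_sum m A
    = (\<Sum>is | length is = m - 1. A (1 # is) * t ^ count_list is 2)
      + t * (\<Sum>is | length is = m - 1. A (2 # is) * t ^ count_list is 2)"
proof -
  have "(if j mod 4 \<in> {0, 1} then 1 else - 1) * (if odd j then b else c)
      + t * ((if j mod 4 \<in> {1, 2} then 1 else - 1) * (if odd j then c else b))
      = t ^ (j - 1) * b + t * (t ^ (j - 1) * c)" if "j \<in> {1..m}" for j b c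
  proof -
    define q r where "q = (j - 1) div 4" and "r = (j - 1) mod 4"
    have j: "j = 4 * q + r + 1" "r < 4" using that by (auto simp: q_def r_def)
    have "t ^ 4 = 1" using assms(2) power_mult[of t 2 2] by simp
    then have tj: "t ^ (j - 1) = t ^ r" by (simp add: j power_add power_mult)
    have t3: "t ^ 3 = - t" using assms(2) by (simp add: power3_eq_cube power2_eq_square)
    have tt: "t * (t * x) = - x" for x
      using assms(2) by (simp add: power2_eq_square mult.assoc[symmetric])
    have "r = 0 \<or> r = 1 \<or> r = 2 \<or> r = 3" using j(2) by auto
    then show ?thesis
    proof (elim disjE)
      assume "r = 0"
      then have "j mod 4 = 1" "odd j" using j(1) by presburger+
      then show ?thesis by (simp add: tj[unfolded One_nat_def] \<open>r = 0\<close>)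
    next
      assume "r = 1"
      then have "j mod 4 = 2" "even j" using j(1) by presburger+
      then show ?thesis by (simp add: tj[unfolded One_nat_def] \<open>r = 1\<close> tt)
    next
      assume "r = 2"
      then have "j mod 4 = 3" "odd j" using j(1) by presburger+
      then show ?thesis by (simp add: tj[unfolded One_nat_def] \<open>r = 2\<close> assms(2))
    next
      assume "r = 3"
      then have "j mod 4 = 0" "even j" using j(1) by presburger+
      then show ?thesis by (simp add: tj[unfolded One_nat_def] \<open>r = 3\<close> t3 tt)
    qed
  qed
  then show ?thesis
    unfolding P_sum_def Q_sum_def sum_by_count[OF assms(1)] sum_distrib_left[of t] sum.distrib[symmetric]
      b_sum_def c_sum_def by (intro sum.cong) simp_all
qed

text \<open>The point \<open>u = 0\<close>, \<open>v = 1\<close> is the isotropic vector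
  \<open>(1, \<i>) / 2\<close>.\<close>

lemma tensor_poly_zero:
  assumes "m \<ge> 1"
  shows "poly (tensor_poly m A 1 + smult \<i> (tensor_poly m A 2)) 0
    = (1/2) ^ (m - 1) * (P_sum m A + \<i> * Q_sum m A)"
proof -
  have iso: "poly (isotropic j) 0 = (if j = 1 then 1/2 else 1/2 * \<i>)" for j
    by (simp add: isotropic_def)
  have "poly (prod_list (map isotropic is)) 0 = (1/2) ^ (m - 1) * \<i> ^ count_list is 2"
    if "length is = m - 1" for "is"
    using poly_prod_list[of "map isotropic is" 0] prod_list_two_valued[of "1/2" \<i> "is"]
    by (simp add: o_def iso that)
  then have "poly (tensor_poly m A i) 0 = (1/2) ^ (m - 1) * (\<Sum>is | length is = m - 1. A (i # is)
      * \<i> ^ count_list is 2)"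
    for i
    unfolding tensor_poly_def tensor_apply_def poly_sum sum_distrib_left
    by (intro sum.cong) simp_all
  then show ?thesis using P_Q_sum_eq[OF assms, of \<i> A] by (simp add: distrib_left mult.left_commute)
qed

text \<open>Top coefficients belong to \<open>u = 1\<close>, \<open>v = 0\<close>, the conjugate
  isotropic vector \<open>(1, -\<i>) / 2\<close>.\<close>

lemma tensor_poly_top:
  assumes "m \<ge> 1"
  shows "poly.coeff (tensor_poly m A 1 - smult \<i> (tensor_poly m A 2)) (m - 1)
    = (1/2) ^ (m - 1) * (P_sum m A - \<i> * Q_sum m A)"
proof -
  have iso: "isotropic = (\<lambda>i. [:if i = 1 then 1/2 else \<i>/2, if i = 1 then 1/2 else 1/2
      * (-\<i>):])"
    by (auto simp: isotropic_def)
  have top: "poly.coeff (prod_list (map isotropic is)) (m - 1) = (1/2) ^ (m - 1)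
      * (-\<i>) ^ count_list is 2"
    if "length is = m - 1" for "is"
    unfolding iso that[symmetric] coeff_prod_list_linear prod_list_two_valued ..
  then have coeff: "poly.coeff (tensor_poly m A i) (m - 1)
     = (1/2) ^ (m - 1) * (\<Sum>is | length is = m - 1. A (i # is) * (-\<i>) ^ count_list is 2)" for i
    unfolding tensor_poly_def tensor_apply_def coeff_sum sum_distrib_left
    by (intro sum.cong) simp_all
  have "P_sum m A - \<i> * Q_sum m A
    = (\<Sum>is | length is = m - 1. A (1 # is) * (-\<i>) ^ count_list is 2)
      - \<i> * (\<Sum>is | length is = m - 1. A (2 # is) * (-\<i>) ^ count_list is 2)"
    using P_Q_sum_eq[OF assms, of "-\<i>" A] by simp
  then show ?thesis
    unfolding coeff_diff coeff_smult coeff by (simp only: right_diff_distrib mult.left_commute)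
qed

context binary_resultant
begin

text \<open>The two isotropic values multiply to \<open>P^2 + Q^2\<close> up to a power of
  \<open>1/4\<close>. One factor \<open>(- 2 * \<i>) ^ N\<close> of \<open>K\<close> cancels the
  factor from the rotation, leaving the exponent \<open>(m - 2) * N\<close>.\<close>

lemma coeff_tensor_pencil:
  assumes m: "m \<ge> 2" and N: "N = c * (m - 1)" and c: "1 \<le> c" "c \<le> M" "N + c = 2 * M"
    and norm: "Phi (stretch c (m - 1) ([:1/2, 1/2:] ^ (m - 1))) (stretch c (m
        - 1) ([:\<i>/2, -\<i>/2:] ^ (m - 1))) = 1"
    and psi: "\<And>l. poly psi l = Phi
      (stretch c (m - 1) (tensor_poly m A 1) - smult l (smult (1/2) (monom 1 M + monom 1 (M - c))))
      (stretch c (m - 1) (tensor_poly m A 2) - smult l (smult (-\<i>/2) (monom 1 M - monom 1 (M - c))))"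
  shows "j > 2 * M \<Longrightarrow> poly.coeff psi j = 0"
    and "poly.coeff psi (2 * M) = (- 2 * \<i>) ^ ((m - 2) * N) * (-1) ^ (c + M) *
      (1/4) ^ ((m - 1) * (M - c)) * ((P_sum m A)\<^sup>2 + (Q_sum m A)\<^sup>2) ^ (M - c)"
proof -
  have m1: "m \<ge> 1" using m by simp
  note pencil = coeff_lambda_pencil[OF N c degree_tensor_poly degree_tensor_poly psi]
  show "poly.coeff psi j = 0" if "j > 2 * M" by (rule pencil(1)[OF that])
  have K: "K = (- 2 * \<i>) ^ ((m - 1) * N)" by (rule K_eq_if_normalized[OF N c(1) norm])
  have "(P_sum m A - \<i> * Q_sum m A) * (P_sum m A + \<i> * Q_sum m A) = (P_sum m A)\<^sup>2 - (\<i>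
      * \<i>) * (Q_sum m A)\<^sup>2"
    unfolding power2_eq_square by algebra
  then have PQ: "(P_sum m A - \<i> * Q_sum m A) * (P_sum m A + \<i> * Q_sum m A) = (P_sum m A)\<^sup>2
      + (Q_sum m A)\<^sup>2"
    by simp
  have "(1/2) ^ (m - 1) * (P_sum m A - \<i> * Q_sum m A) * ((1/2) ^ (m - 1) * (P_sum m A + \<i>
      * Q_sum m A))
     = ((1/2) * (1/2)) ^ (m - 1) * ((P_sum m A - \<i> * Q_sum m A) * (P_sum m A + \<i> * Q_sum m A))"
    unfolding power_mult_distrib by (simp only: mult_ac)
  also have "\<dots> = (1/4) ^ (m - 1) * ((P_sum m A)\<^sup>2 + (Q_sum m A)\<^sup>2)"
    unfolding PQ by simp
  finally have prod: "(1/2) ^ (m - 1) * (P_sum m A - \<i> * Q_sum m A) * ((1/2) ^ (m - 1) * (P_sum m A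
      + \<i> * Q_sum m A))
     = (1/4) ^ (m - 1) * ((P_sum m A)\<^sup>2 + (Q_sum m A)\<^sup>2)" .
  have "m - 1 = Suc (m - 2)" using m by simp
  then have K': "K = (- 2 * \<i>) ^ N * (- 2 * \<i>) ^ ((m - 2) * N)"
    unfolding K by (simp add: power_add)
  have "(- 2 * \<i>) ^ N * poly.coeff psi (2 * M) = (- 2 * \<i>) ^ N * ((- 2 * \<i>) ^ ((m - 2) * N)
      * (-1) ^ (c + M) *
      (1/4) ^ ((m - 1) * (M - c)) * ((P_sum m A)\<^sup>2 + (Q_sum m A)\<^sup>2) ^ (M - c))"
    using pencil(2) unfolding tensor_poly_zero[OF m1] tensor_poly_top[OF m1] prod K' power_mult_distrib
        power_mult
    by (simp only: mult.assoc)
  then show "poly.coeff psi (2 * M) = (- 2 * \<i>) ^ ((m - 2) * N) * (-1) ^ (c + M) *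
      (1/4) ^ ((m - 1) * (M - c)) * ((P_sum m A)\<^sup>2 + (Q_sum m A)\<^sup>2) ^ (M - c)"
    by (subst (asm) mult_cancel_left) simp
qed

end

section \<open>The forms of the E-characteristic polynomial\<close>

lemma isotropic_coordinates:
  fixes p q :: "('v, complex) mpoly"
  shows "p = const (1/2) * (p + const \<i> * q) + const (1/2) * (p - const \<i> * q)"
    and "q = const (-\<i>/2) * (p + const \<i> * q) + const (\<i>/2) * (p - const \<i> * q)"
    and "(p + const \<i> * q) * (p - const \<i> * q) = p ^ 2 + q ^ 2"
proof -
  have half: "const (1/2) + const (1/2) = (1 :: ('v, complex) mpoly)"
    and cancel: "const (-\<i>/2) + const (\<i>/2) = (0 :: ('v, complex) mpoly)"
    by (simp_all add: const_add[symmetric])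
  have rot: "const (-\<i>/2) * const \<i> - const (\<i>/2) * const \<i> = (1 :: ('v, complex) mpoly)"
    by (simp add: const_mult[symmetric] const_diff[symmetric])
  have sq: "const \<i> * const \<i> = (-1 :: ('v, complex) mpoly)"
    by (simp add: const_mult[symmetric] const_minus)
  have "const (1/2) * (p + const \<i> * q) + const (1/2) * (p - const \<i> * q) = (const (1/2)
      + const (1/2)) * p"
    by (simp add: algebra_simps)
  then show "p = const (1/2) * (p + const \<i> * q) + const (1/2) * (p - const \<i> * q)"
    by (simp add: half)
  have "const (-\<i>/2) * (p + const \<i> * q) + const (\<i>/2) * (p - const \<i> * q)
     = (const (-\<i>/2) + const (\<i>/2)) * p + (const (-\<i>/2) * const \<i> - const (\<i>/2)
         * const \<i>) * q"
    by (simp only: algebra_simps)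
  then show "q = const (-\<i>/2) * (p + const \<i> * q) + const (\<i>/2) * (p - const \<i> * q)"
    by (simp only: cancel rot) simp
  have "(p + const \<i> * q) * (p - const \<i> * q) = p * p - (const \<i> * const \<i>) * (q * q)"
    by (simp add: algebra_simps)
  then show "(p + const \<i> * q) * (p - const \<i> * q) = p ^ 2 + q ^ 2"
    by (simp add: sq power2_eq_square)
qed

lemma combination_stretch:
  assumes "c \<ge> 1" "\<And>k. k \<le> n \<Longrightarrow> e (c * k) = u ^ k * v ^ (n - k)"
  shows "combination (c * n) e (stretch c n f) = homogenize n u v f"
  unfolding stretch_def combination_sum homogenize_def
  by (intro sum.cong) (use assms in \<open>simp_all add: combination_monom\<close>)

text \<open>Shared by both parities. The lift is fixed at multiples of \<open>c\<close> and at the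
  exponents \<open>M\<close> and \<open>M - c\<close>; in odd order the latter are odd, so they form
  a separate condition.\<close>

lemma
  fixes y :: "2 \<Rightarrow> ('v, complex) mpoly"
  assumes c: "c \<ge> 1" and u: "u = y 1 + const \<i> * y 2" and v: "v = y 1 - const \<i> * y 2"
    and e: "\<And>k. k \<le> m - 1 \<Longrightarrow> e (c * k) = u ^ k * v ^ (m - 1 - k)"
  shows combination_power:
      "combination (c * (m - 1)) e (stretch c (m - 1) ([:1/2, 1/2:] ^ (m - 1))) = y 1 ^ (m - 1)"
      "combination (c * (m - 1)) e (stretch c (m - 1) ([:\<i>/2, -\<i>/2:] ^ (m - 1))) = y 2 ^ (m - 1)"
    and combination_pencil: "M \<le> c * (m - 1) \<Longrightarrow> e M = W * u \<Longrightarrow> e (M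
        - c) = W * v \<Longrightarrow>
      combination (c * (m - 1)) e (stretch c (m - 1) (tensor_poly m A 1)
          - smult l (smult (1/2) (monom 1 M + monom 1 (M - c))))
        = tensor_apply m (\<lambda>is. const (A is)) y 1 - const l * W * y 1"
      "M \<le> c * (m - 1) \<Longrightarrow> e M = W * u \<Longrightarrow> e (M - c) = W * v
          \<Longrightarrow>
      combination (c * (m - 1)) e (stretch c (m - 1) (tensor_poly m A 2)
          - smult l (smult (-\<i>/2) (monom 1 M - monom 1 (M - c))))
        = tensor_apply m (\<lambda>is. const (A is)) y 2 - const l * W * y 2"
proof -
  have stretch: "combination (c * (m - 1)) e (stretch c (m - 1) f) = homogenize (m - 1) u v f" for f
    by (rule combination_stretch[OF c]) (rule e)
  have y: "y 1 = const (1/2) * u + const (1/2) * v" "y 2 = const (-\<i>/2) * u + const (\<i>/2) * v"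
    unfolding u v by (rule isotropic_coordinates)+
  have pow: "homogenize n u v ([:b, a:] ^ n) = (const a * u + const b * v) ^ n" for a b n
    using homogenize_prod_list_linear[of "replicate n ()" u v "\<lambda>_. b" "\<lambda>_. a"]
    by (simp add: map_replicate prod_list_replicate)
  show "combination (c * (m - 1)) e (stretch c (m - 1) ([:1/2, 1/2:] ^ (m - 1))) = y 1 ^ (m - 1)"
    unfolding stretch pow y(1)[symmetric] ..
  show "combination (c * (m - 1)) e (stretch c (m - 1) ([:\<i>/2, -\<i>/2:] ^ (m - 1))) = y 2 ^ (m - 1)"
    unfolding stretch pow y(2)[symmetric] ..
  assume M: "M \<le> c * (m - 1)" and W: "e M = W * u" "e (M - c) = W * v"
  have Mc: "M - c \<le> c * (m - 1)" using M by simp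
  have "const (1/2) * (W * u + W * v) = W * y 1"
    by (subst y(1)) (simp add: algebra_simps)
  then show "combination (c * (m - 1)) e (stretch c (m - 1) (tensor_poly m A 1)
          - smult l (smult (1/2) (monom 1 M + monom 1 (M - c))))
        = tensor_apply m (\<lambda>is. const (A is)) y 1 - const l * W * y 1"
    unfolding combination_diff combination_smult combination_add stretch
      homogenize_tensor_poly[OF y] combination_monom[OF M] combination_monom[OF Mc] W
    by (simp add: mult.assoc)
  have "const (-\<i>/2) * (W * u - W * v) = W * y 2"
    by (subst y(2)) (simp add: algebra_simps const_minus)
  then show "combination (c * (m - 1)) e (stretch c (m - 1) (tensor_poly m A 2)
          - smult l (smult (-\<i>/2) (monom 1 M - monom 1 (M - c))))
        = tensor_apply m (\<lambda>is. const (A is)) y 2 - const l * W * y 2"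
    unfolding combination_diff combination_smult stretch
      homogenize_tensor_poly[OF y] combination_monom[OF M] combination_monom[OF Mc] W
    by (simp add: mult.assoc)
qed

lemma coeff_eval_tensor_apply:
  fixes w :: "2 \<Rightarrow> ('v::finite, complex poly) mpoly"
  shows "coeff_eval z (tensor_apply m (lift_tensor A) w i)
    = tensor_apply m (\<lambda>is. const (A is)) (\<lambda>k. coeff_eval z (w k)) i"
  by (simp add: tensor_apply_def coeff_eval_simps lift_tensor_def o_def)

lemma isotropic_values_zero:
  fixes a b :: complex
  assumes "a + \<i> * b = 0" "a - \<i> * b = 0"
  shows "a = 0" "b = 0"
proof -
  have "2 * a = (a + \<i> * b) + (a - \<i> * b)" "2 * \<i> * b = (a + \<i> * b) - (a - \<i> * b)"
    by (simp_all add: algebra_simps)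
  then show "a = 0" "b = 0" using assms by auto
qed

subsection \<open>Even order\<close>

definition even_basis :: "nat \<Rightarrow> nat \<Rightarrow> (2, complex) mpoly" where
  "even_basis n k = (var 1 + const \<i> * var 2) ^ k * (var 1 - const \<i> * var 2) ^ (n - k)"

text \<open>There is no third form, so the curve is the whole projective line, with parameter
  \<open>s = u / v\<close> and the point \<open>v = 0\<close> at infinity.\<close>

lemma binary_resultant_even:
  assumes m: "m \<ge> 2" and R: "is_resultant (even_degrees m) R"
  shows "binary_resultant (m - 1) (\<lambda>f g. res_at id R
    ((\<lambda>_. 0)(1 := combination (m - 1) (even_basis (m - 1)) f, 2 := combination (m
        - 1) (even_basis (m - 1)) g)))"
proof (rule binary_resultant_on_curve[OF R, where n = "m - 1"])
  let ?n = "m - 1"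
  have compl: "UNIV - {1 :: 2} = {2}" "UNIV - {2 :: 2} = {1}" by (auto simp: UNIV_2)
  show "(\<Prod>k\<in>UNIV - {1}. even_degrees m k) = ?n" "(\<Prod>k\<in>UNIV - {2}. even_degrees m k)
      = ?n"
    by (simp_all add: compl even_degrees_def)
  have no_other: False if "k \<noteq> 1" "k \<noteq> 2" for k :: 2 using exhaust_2[of k] that by simp
  show "homogeneous (even_degrees m k) 0" if "k \<noteq> 1" "k \<noteq> 2" for k :: 2
    using no_other[OF that] by simp
  show "homogeneous ?n (even_basis ?n k)" if "k \<le> ?n" for k
  proof -
    have "homogeneous (1 * k + 1 * (?n - k)) (even_basis ?n k)"
      unfolding even_basis_def
      by (intro homogeneous_mult homogeneous_power homogeneous_add homogeneous_diff
          homogeneous_const_mult homogeneous_var)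
    moreover have "1 * k + 1 * (?n - k) = ?n" using that by simp
    ultimately show ?thesis by (simp only:)
  qed
  have eval: "meval id x (even_basis n k) = (x 1 + \<i> * x 2) ^ k * (x 1 - \<i> * x 2) ^ (n - k)"
      for x n k
    by (simp add: even_basis_def meval_simps)
  show "(\<exists>c s. c \<noteq> 0 \<and> (\<forall>k\<le>?n. meval id x (even_basis ?n k) = c
      * s ^ k)) \<or>
      (\<exists>c. c \<noteq> 0 \<and> (\<forall>k\<le>?n. meval id x (even_basis ?n k) = (if k
          = ?n then c else 0)))"
    if "\<exists>k. x k \<noteq> 0" for x :: "2 \<Rightarrow> complex"
  proof -
    define U V where "U = x 1 + \<i> * x 2" and "V = x 1 - \<i> * x 2"
    have eval': "meval id x (even_basis ?n k) = U ^ k * V ^ (?n - k)" for k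
      by (simp add: eval U_def V_def)
    show ?thesis
    proof (cases "V = 0")
      case False
      have "U ^ k * V ^ (?n - k) = V ^ ?n * (U / V) ^ k" if "k \<le> ?n" for k
      proof -
        have "V ^ k * V ^ (?n - k) = V ^ ?n" using that
            by (simp only: power_add[symmetric] le_add_diff_inverse)
        then show ?thesis unfolding power_divide using False
            by (simp add: nonzero_eq_divide_eq mult.commute)
      qed
      then show ?thesis using False eval' by (metis power_not_zero)
    next
      case True
      have "U \<noteq> 0"
        proof
        assume "U = 0"
        then have "x 1 = 0" "x 2 = 0"
          using isotropic_values_zero[of "x 1" "x 2"] True by (simp_all add: U_def V_def)
        then show False using that exhaust_2 by metis
      qed
      moreover have "U ^ k * V ^ (?n - k) = (if k = ?n then U ^ ?n else 0)" if "k \<le> ?n" for k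
        using True that by auto
      ultimately show ?thesis using eval' by (metis power_not_zero)
    qed
  qed
  show "\<exists>x. (\<exists>k. x k \<noteq> 0) \<and> (\<forall>k. k \<noteq> 1
      \<longrightarrow> k \<noteq> 2 \<longrightarrow> meval id x 0 = 0) \<and>
      (\<forall>k\<le>?n. meval id x (even_basis ?n k) = s ^ k)" for s
  proof (intro exI conjI)
    \<comment> \<open>The solution of \<open>u = s\<close>, \<open>v = 1\<close>. Its first
      coordinate vanishes only at \<open>s = -1\<close>, where the second does not.\<close>
    let ?x = "\<lambda>i :: 2. if i = 1 then (s + 1) / 2 else -\<i> * (s - 1) / 2"
    have "(s + 1) / 2 + \<i> * (-\<i> * (s - 1) / 2) = s" "(s + 1) / 2 - \<i> * (-\<i> * (s - 1) / 2)
        = 1"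
      by (simp_all add: field_simps)
    then show "\<forall>k\<le>?n. meval id ?x (even_basis ?n k) = s ^ k"
      unfolding eval by simp
    show "?x (if s = -1 then 2 else 1) \<noteq> 0" by (auto simp: eq_neg_iff_add_eq_0)
  qed simp
  show "\<exists>x. (\<exists>k. x k \<noteq> 0) \<and> (\<forall>k. k \<noteq> 1
      \<longrightarrow> k \<noteq> 2 \<longrightarrow> meval id x 0 = 0) \<and>
      (\<forall>k\<le>?n. meval id x (even_basis ?n k) = (if k = ?n then 1 else 0))"
  proof (intro exI conjI)
    let ?x = "\<lambda>i :: 2. if i = 1 then 1 / 2 else -\<i> / 2"
    show "\<forall>k\<le>?n. meval id ?x (even_basis ?n k) = (if k = ?n then 1 else 0)"
      unfolding eval by (auto simp: power_0_left)
    show "?x 1 \<noteq> 0" by simp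
  qed simp
qed (use m in \<open>simp_all add: even_degrees_def\<close>)

lemma echar_poly_even:
  assumes m: "m \<ge> 2" "even m" and R: "is_resultant (even_degrees m) R2"
  shows "j > m \<Longrightarrow> poly.coeff (echar_poly R2 R3 m A) j = 0"
    and "poly.coeff (echar_poly R2 R3 m A) m = ((P_sum m A)\<^sup>2 + (Q_sum m A)\<^sup>2) ^ ((m
        - 2) div 2)"
proof -
  define n where "n = m - 1"
  define Phi where "Phi f g = res_at id R2
    ((\<lambda>_. 0)(1 := combination n (even_basis n) f, 2 := combination n (even_basis n) g))" for f g
  interpret binary_resultant n Phi
    unfolding Phi_def n_def by (rule binary_resultant_even[OF m(1) R])
  obtain k where k: "m = 2 * k + 2"
    using m by (metis add.commute evenE le_Suc_ex mult_2_right dvd_add_right_iff even_numeral)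
  define M where "M = k + 1"
  define u v :: "(2, complex) mpoly" where "u = var 1 + const \<i> * var 2" and "v = var 1 - const \<i>
      * var 2"
  define W where "W = (u * v) ^ k"
  have e: "even_basis n (1 * j) = u ^ j * v ^ (n - j)" for j
    by (simp add: even_basis_def u_def v_def)
  have n: "n = 2 * k + 1" by (simp add: n_def k)
  \<comment> \<open>Here \<open>n = 2 * k + 1\<close> and \<open>M = k + 1\<close>, so
    \<open>(u v) ^ k * u\<close> and \<open>(u v) ^ k * v\<close> are the two middle basis
    elements.\<close>
  have eM: "even_basis n M = W * u" "even_basis n (M - 1) = W * v"
    using e[of M] e[of "M - 1"] by (simp_all add: W_def M_def n power_mult_distrib)
  note comb = combination_power[of 1 u var v m "even_basis n", folded n_def, OF _ u_def v_def e]
    combination_pencil[of 1 u var v m "even_basis n" M W, folded n_def, OF _ u_def v_def e _ eM]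
  have "(1 :: 2) \<noteq> 2" by simp
  have uv: "(\<Sum>k\<in>UNIV. var k ^ 2) = u * v"
    by (simp add: sum_2 u_def v_def isotropic_coordinates(3))
  have forms: "(\<lambda>i. coeff_eval l (even_forms m A i))
     = (\<lambda>_. 0)(1 := tensor_apply m (\<lambda>is. const (A is)) var 1 - const l * W * var 1,
               2 := tensor_apply m (\<lambda>is. const (A is)) var 2 - const l * W * var 2)" for l
  proof
    fix i :: 2
    have "coeff_eval l (even_forms m A i)
      = tensor_apply m (\<lambda>is. const (A is)) var i - const l * (\<Sum>k\<in>UNIV. var k ^ 2) ^ k
          * var i"
      by (simp add: even_forms_def coeff_eval_diff coeff_eval_tensor_apply coeff_eval_mult
          coeff_eval_power coeff_eval_sum lam_def k)
    then show "coeff_eval l (even_forms m A i)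
        = ((\<lambda>_. 0)(1 := tensor_apply m (\<lambda>is. const (A is)) var 1 - const l * W * var 1,
               2 := tensor_apply m (\<lambda>is. const (A is)) var 2 - const l * W * var 2)) i"
      using exhaust_2[of i] by (auto simp: uv W_def)
  qed
  have vars: "(\<lambda>i. var i ^ even_degrees m i) = (\<lambda>_. 0)(1 := var 1 ^ n, 2 := var 2 ^ n)"
  proof
    fix i :: 2
    show "var i ^ even_degrees m i = ((\<lambda>_. 0)(1 := var 1 ^ n, 2 := var 2 ^ n)) i"
      using exhaust_2[of i] by (auto simp: even_degrees_def n_def)
  qed
  have "res_at id R2 (\<lambda>i. var i ^ even_degrees m i) = 1"
    using R unfolding is_resultant_def by blast
  then have "res_at id R2 ((\<lambda>_. 0)(1 := var 1 ^ n, 2 := var 2 ^ n)) = 1"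
    unfolding vars .
  then have norm: "Phi (stretch 1 n ([:1/2, 1/2:] ^ n)) (stretch 1 n ([:\<i>/2, -\<i>/2:] ^ n)) = 1"
    using comb(1,2) by (simp add: Phi_def)
  have psi: "poly (echar_poly R2 R3 m A) l = Phi
      (stretch 1 n (tensor_poly m A 1) - smult l (smult (1/2) (monom 1 M + monom 1 (M - 1))))
      (stretch 1 n (tensor_poly m A 2) - smult l (smult (-\<i>/2) (monom 1 M - monom 1 (M - 1))))" for l
    using m comb(3,4) unfolding echar_poly_def Phi_def
        by (simp add: poly_res_at forms n M_def del: smult_smult)
  have M2: "n + 1 = 2 * M" "1 \<le> M" by (simp_all add: n M_def)
  have n1: "n = 1 * (m - 1)" by (simp add: n_def)
  note coeffs = coeff_tensor_pencil[OF m(1) n1 order.refl M2(2) M2(1), folded n_def, OF norm psi]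
  show "poly.coeff (echar_poly R2 R3 m A) j = 0" if "j > m"
    using coeffs(1)[of j] that by (simp add: M_def k)
  \<comment> \<open>Since \<open>n\<close> is odd, all three factors are powers with exponent
    \<open>k * n\<close>, of \<open>-4\<close>, \<open>-1\<close> and \<open>1/4\<close>.\<close>
  have "(- 2 * \<i>) ^ ((m - 2) * n) * (-1) ^ (1 + M) * (1/4) ^ (n * (M - 1)) = 1"
  proof -
    have "(m - 2) * n = 2 * (k * n)" by (simp add: k)
    then have "(- 2 * \<i>) ^ ((m - 2) * n) = (-4) ^ (k * n)"
      by (simp only: power_mult) (simp add: power2_eq_square)
    moreover have "(-1 :: complex) ^ (1 + M) = (-1) ^ (k * n)"
      by (cases "even k") (simp_all add: M_def n)
    moreover have "(1/4) ^ (n * (M - 1)) = (1/4 :: complex) ^ (k * n)" by (simp add: M_def mult.commute)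
    ultimately show ?thesis by (simp only: power_mult_distrib[symmetric]) simp
  qed
  then show "poly.coeff (echar_poly R2 R3 m A) m = ((P_sum m A)\<^sup>2 + (Q_sum m A)\<^sup>2) ^ ((m
      - 2) div 2)"
    using coeffs(2) by (simp add: k M_def)
qed

subsection \<open>Odd order\<close>

text \<open>The conic \<open>x\<^sub>1\<^sup>2 + x\<^sub>2\<^sup>2
    = x\<^sub>0\<^sup>2\<close> is parametrized by \<open>u = s\<^sup>2\<close>, \<open>v
        = 1\<close>, \<open>x\<^sub>0 = s\<close>. The odd
  powers of \<open>s\<close> are lifted so that \<open>s ^ (n \<plusminus> 1)\<close> becomes
      \<open>x\<^sub>0 ^ (n - 1) * u\<close> and
  \<open>x\<^sub>0 ^ (n - 1) * v\<close>.\<close>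

definition odd_basis :: "nat \<Rightarrow> nat \<Rightarrow> (2 option, complex) mpoly" where
  "odd_basis n k = (let u = var (Some 1) + const \<i> * var (Some 2); v = var (Some 1) - const \<i>
      * var (Some 2)
     in if even k then u ^ (k div 2) * v ^ (n - k div 2)
     else if k < n then var None ^ k * v ^ (n - k)
     else var None ^ (2 * n - k) * u ^ (k - n))"

definition conic :: "(2 option, complex) mpoly" where
  "conic = (\<Sum>k\<in>UNIV. var (Some k) ^ 2) - var None ^ 2"

lemma homogeneous_conic: "homogeneous 2 conic"
  unfolding conic_def
  using homogeneous_power[OF homogeneous_var, where n = 2]
  by (intro homogeneous_diff homogeneous_sum) simp_all

lemma option_2_cases: "k = None \<or> k = Some (1 :: 2) \<or> k = Some 2"
  using exhaust_2 by (cases k) auto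

text \<open>On the conic, a point with \<open>v\<close> nonzero has parameter
  \<open>s = x_0 / v\<close>, because \<open>u v = x_0 ^ 2\<close>. If \<open>v = 0\<close> then
  \<open>x_0 = 0\<close>, which leaves one point at infinity.\<close>

lemma binary_resultant_odd:
  assumes m: "m \<ge> 3" "odd m" and R: "is_resultant (odd_degrees m) R"
  shows "binary_resultant (2 * (m - 1)) (\<lambda>f g. res_at id R
    ((\<lambda>_. conic)(Some 1 := combination (2 * (m - 1)) (odd_basis (m - 1)) f,
                 Some 2 := combination (2 * (m - 1)) (odd_basis (m - 1)) g)))"
proof (rule binary_resultant_on_curve[OF R, where n = "m - 1"])
  define n where "n = m - 1"
  have n: "even n" "n \<ge> 2" using m by (auto simp: n_def)
  have compl: "UNIV - {Some 1 :: 2 option} = {None, Some 2}" "UNIV - {Some 2 :: 2 option}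
      = {None, Some 1}"
    using option_2_cases by auto
  show "(\<Prod>k\<in>UNIV - {Some 1}. odd_degrees m k) = 2 * (m - 1)"
    "(\<Prod>k\<in>UNIV - {Some 2}. odd_degrees m k) = 2 * (m - 1)"
    by (simp_all add: compl odd_degrees_def)
  have other: "k = None" if "k \<noteq> Some 1" "k \<noteq> Some 2" for k :: "2 option"
    using option_2_cases[of k] that by simp
  show "homogeneous (odd_degrees m k) conic" if "k \<noteq> Some 1" "k \<noteq> Some 2" for k
    using other[OF that] homogeneous_conic by (simp add: odd_degrees_def)
  show "homogeneous (m - 1) (odd_basis (m - 1) k)" if "k \<le> 2 * (m - 1)" for k
  proof -
    have hom: "homogeneous (1 * a + 1 * b) (p ^ a * q ^ b)" if "homogeneous 1 p" "homogeneous 1 q"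
      for p q :: "(2 option, complex) mpoly" and a b
      by (intro homogeneous_mult homogeneous_power that)
    have uv: "homogeneous 1 (var (Some 1) + const \<i> * var (Some 2) :: (2 option, complex) mpoly)"
      "homogeneous 1 (var (Some 1) - const \<i> * var (Some 2) :: (2 option, complex) mpoly)"
      by (intro homogeneous_add homogeneous_diff homogeneous_const_mult homogeneous_var)+
    have deg: "1 * (k div 2) + 1 * (m - 1 - k div 2) = m - 1"
      "k < m - 1 \<Longrightarrow> 1 * k + 1 * (m - 1 - k) = m - 1"
      "\<not> k < m - 1 \<Longrightarrow> 1 * (2 * (m - 1) - k) + 1 * (k - (m - 1)) = m - 1"
      using that by auto
    show ?thesis
      using hom[OF uv, of "k div 2" "m - 1 - k div 2"]
        hom[OF homogeneous_var[of None] uv(2), of k "m - 1 - k"]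
        hom[OF homogeneous_var[of None] uv(1), of "2 * (m - 1) - k" "k - (m - 1)"]
      unfolding odd_basis_def Let_def using deg by (auto simp del: One_nat_def)
  qed
  have eval_conic: "meval id x conic = (x (Some 1) + \<i> * x (Some 2)) * (x (Some 1) - \<i>
      * x (Some 2)) - x None ^ 2" for x
  proof -
    have "(x (Some 1) + \<i> * x (Some 2)) * (x (Some 1) - \<i> * x (Some 2))
       = x (Some 1) ^ 2 - (\<i> * \<i>) * x (Some 2) ^ 2"
      by (simp only: power2_eq_square algebra_simps)
    then show ?thesis by (simp add: conic_def meval_simps sum_2)
  qed
  have eval: "meval id x (odd_basis n k) = (let U = x (Some 1) + \<i> * x (Some 2); V = x (Some 1)
      - \<i> * x (Some 2)
     in if even k then U ^ (k div 2) * V ^ (n - k div 2)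
     else if k < n then x None ^ k * V ^ (n - k)
     else x None ^ (2 * n - k) * U ^ (k - n))" for x k
    by (simp add: odd_basis_def meval_simps Let_def)
  have finite: "meval id x (odd_basis n k) = V ^ n * s ^ k"
    if "x (Some 1) + \<i> * x (Some 2) = s ^ 2 * V" "x (Some 1) - \<i> * x (Some 2) = V" "x None = s
        * V" "k \<le> 2 * n"
    for x k s V
  proof -
    consider "even k" | "odd k" "k < n" | "odd k" "\<not> k < n" by blast
    then show ?thesis
    proof cases
      case 1
      then obtain j where j: "k = 2 * j" by blast
      then have "V ^ j * V ^ (n - j) = V ^ n" using that by (simp flip: power_add)
      then show ?thesis using 1 that by (simp add: eval j power_mult_distrib power_mult)
    next
      case 2
      then have "V ^ k * V ^ (n - k) = V ^ n" by (simp flip: power_add)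
      then show ?thesis using 2 that by (simp add: eval power_mult_distrib)
    next
      case 3
      have "(2 * n - k) + (k - n) = n" "(2 * n - k) + 2 * (k - n) = k" using 3 that by auto
      then have "V ^ (2 * n - k) * V ^ (k - n) = V ^ n" "s ^ (2 * n - k) * (s ^ 2) ^ (k - n) = s ^ k"
        by (simp_all flip: power_add power_mult)
      moreover have "(s * V) ^ (2 * n - k) * (s ^ 2 * V) ^ (k - n)
         = (V ^ (2 * n - k) * V ^ (k - n)) * (s ^ (2 * n - k) * (s ^ 2) ^ (k - n))"
        by (simp only: power_mult_distrib mult_ac)
      ultimately have "(s * V) ^ (2 * n - k) * (s ^ 2 * V) ^ (k - n) = V ^ n * s ^ k" by (simp only:)
      then show ?thesis using 3 that by (simp add: eval)
    qed
  qed
  have infinite: "meval id x (odd_basis n k) = (if k = 2 * n then U ^ n else 0)"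
    if "x (Some 1) + \<i> * x (Some 2) = U" "x (Some 1) - \<i> * x (Some 2) = 0" "x None = 0"
        "k \<le> 2 * n"
    for x k U
  proof -
    \<comment> \<open>Below the top exponent, every basis element contains a positive power of
      \<open>v\<close> (even \<open>k\<close>) or of \<open>x_0\<close> (odd \<open>k\<close>), so
      it vanishes at infinity.\<close>
    have "(\<exists>j. k = 2 * j \<and> j < n) \<or> k = 2 * n \<or> odd k" using that(4) by presburger
    then consider j where "k = 2 * j" "j < n" | "k = 2 * n" | "odd k" by blast
    then show ?thesis
    proof cases
      case 3
      then have "k \<noteq> 2 * n" "k > 0" by (auto simp: odd_pos)
      then show ?thesis using 3 that by (simp add: eval)
    qed (use that in \<open>auto simp: eval\<close>)
  qed
  show "(\<exists>c s. c \<noteq> 0 \<and> (\<forall>k\<le>2 * (m - 1). meval id x (odd_basis (m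
      - 1) k) = c * s ^ k)) \<or>
      (\<exists>c. c \<noteq> 0 \<and> (\<forall>k\<le>2 * (m - 1). meval id x (odd_basis (m - 1) k)
          = (if k = 2 * (m - 1) then c else 0)))"
    if x: "\<exists>k. x k \<noteq> 0" and conic: "\<And>k. k \<noteq> Some 1
        \<Longrightarrow> k \<noteq> Some 2 \<Longrightarrow> meval id x conic = 0"
    for x :: "2 option \<Rightarrow> complex"
  proof -
    define U V where "U = x (Some 1) + \<i> * x (Some 2)" and "V = x (Some 1) - \<i> * x (Some 2)"
    have UV: "U * V = x None ^ 2" using conic[of None] eval_conic[of x] by (simp add: U_def V_def)
    show ?thesis
    proof (cases "V = 0")
      case False
      have "U = (x None / V) ^ 2 * V" using UV False by (simp add: power2_eq_square field_simps)
      then have *: "x (Some 1) + \<i> * x (Some 2) = (x None / V) ^ 2 * V" by (simp only: U_def)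
      have "x None = x None / V * V" using False by simp
      from finite[OF * V_def[symmetric] this]
      have "meval id x (odd_basis n k) = V ^ n * (x None / V) ^ k" if "k \<le> 2 * n" for k
        using that by blast
      then show ?thesis using False unfolding n_def by (metis power_not_zero)
    next
      case True
      then have None: "x None = 0" using UV by simp
      have "U \<noteq> 0"
      proof
        assume "U = 0"
        then have "x (Some 1) = 0" "x (Some 2) = 0"
          using isotropic_values_zero[of "x (Some 1)" "x (Some 2)"] True by (simp_all add: U_def V_def)
        then show False using x None option_2_cases by metis
      qed
      moreover have "meval id x (odd_basis n k) = (if k = 2 * n then U ^ n else 0)" if "k \<le> 2 * n"
          for k
        using infinite[of x U k] True None that by (simp add: U_def V_def)
      ultimately show ?thesis unfolding n_def by (metis power_not_zero)
    qed
  qed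
  show "\<exists>x. (\<exists>k. x k \<noteq> 0) \<and> (\<forall>k. k \<noteq> Some 1
      \<longrightarrow> k \<noteq> Some 2 \<longrightarrow> meval id x conic = 0) \<and>
      (\<forall>k\<le>2 * (m - 1). meval id x (odd_basis (m - 1) k) = s ^ k)" for s
  proof -
    define x where "x k = (if k = None then s else if k = Some (1 :: 2) then (s ^ 2 + 1) / 2 else -\<i>
        * (s ^ 2 - 1) / 2)" for k
    have U: "x (Some 1) + \<i> * x (Some 2) = s ^ 2 * 1" and V: "x (Some 1) - \<i> * x (Some 2) = 1"
      by (simp_all add: x_def field_simps)
    have N: "x None = s * 1" by (simp add: x_def)
    have "x (Some 1) \<noteq> 0 \<or> x (Some 2) \<noteq> 0" using V by auto
    moreover have "meval id x conic = 0" by (simp add: eval_conic U V N)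
    moreover have "meval id x (odd_basis (m - 1) k) = s ^ k" if "k \<le> 2 * (m - 1)" for k
      using finite[OF U V N, of k] that by (simp add: n_def)
    ultimately show ?thesis by blast
  qed
  show "\<exists>x. (\<exists>k. x k \<noteq> 0) \<and> (\<forall>k. k \<noteq> Some 1
      \<longrightarrow> k \<noteq> Some 2 \<longrightarrow> meval id x conic = 0) \<and>
      (\<forall>k\<le>2 * (m - 1). meval id x (odd_basis (m - 1) k) = (if k = 2 * (m
          - 1) then 1 else 0))"
  proof -
    define x where "x k = (if k = None then 0 else if k = Some (1 :: 2) then 1 / 2 else -\<i> / 2)" for k
    have U: "x (Some 1) + \<i> * x (Some 2) = 1" and V: "x (Some 1) - \<i> * x (Some 2) = 0"
      by (simp_all add: x_def)
    have N: "x None = 0" by (simp add: x_def)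
    have "x (Some 1) \<noteq> 0" by (simp add: x_def)
    moreover have "meval id x conic = 0" by (simp add: eval_conic U V N)
    moreover have "meval id x (odd_basis (m - 1) k) = (if k = 2 * (m - 1) then 1 else 0)" if "k \<le> 2
        * (m - 1)" for k
      using infinite[OF U V N, of k] that by (simp add: n_def)
    ultimately show ?thesis by blast
  qed
qed (use m in \<open>simp_all add: odd_degrees_def\<close>)

text \<open>Deforming \<open>x\<^sub>1\<^sup>2 + x\<^sub>2\<^sup>2
    - x\<^sub>0\<^sup>2\<close> to \<open>- x\<^sub>0\<^sup>2\<close> keeps the resultant nonzero,
        hence constant.\<close>

lemma res_at_conic:
  assumes m: "m \<ge> 3" "odd m" and R: "is_resultant (odd_degrees m) R"
  shows "res_at id R ((\<lambda>_. conic)(Some 1 := var (Some 1) ^ (m - 1), Some 2 := var (Some 2) ^ (m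
      - 1))) = 1"
proof -
  define G where "G p = (\<lambda>_ :: 2 option. p :: (2 option, complex) mpoly)(Some 1 := var (Some 1)
      ^ (m - 1), Some 2 := var (Some 2) ^ (m - 1))" for p
  define S :: "(2 option, complex) mpoly" where "S = (\<Sum>k\<in>UNIV. var (Some k) ^ 2)"
  define H where "H t = G (const t * S - var None ^ 2)" for t
  have "bipoly (\<lambda>x y. res_at id R (H x))"
  proof (rule bipoly_res_at)
    fix i \<alpha>
    have "bipoly (\<lambda>x y. Poly_Mapping.lookup (const x * S - var None ^ 2) \<alpha>)"
      unfolding lookup_minus lookup_const_mult by (intro bipoly_intros)
    then show "bipoly (\<lambda>x y. Poly_Mapping.lookup (H x i) \<alpha>)"
      using option_2_cases[of i] by (auto simp: H_def G_def bipoly_const)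
  qed
  then obtain q where q: "\<And>t. res_at id R (H t) = poly q t"
    by (rule bipoly_poly_fst[where y = 0]) blast
  have "poly q t \<noteq> 0" for t
  proof
    have hom: "homogeneous (odd_degrees m i) (H t i)" for i
    proof -
      have "homogeneous (1 * k) (var v ^ k :: (2 option, complex) mpoly)" for v k
        by (rule homogeneous_power[OF homogeneous_var])
      then have pow: "homogeneous k (var v ^ k :: (2 option, complex) mpoly)" for v k by simp
      have "homogeneous 2 (const t * S - var None ^ 2)"
        unfolding S_def by (intro homogeneous_diff homogeneous_const_mult homogeneous_sum pow)
      then show ?thesis using option_2_cases[of i] pow by (auto simp: H_def G_def odd_degrees_def)
    qed
    assume "poly q t = 0"
    then obtain x where x: "\<exists>i. x i \<noteq> 0" "\<And>i. meval id x (H t i) = 0"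
      using res_at_zero_iff[OF R, of "H t"] hom q by auto
    have m1: "m - 1 > 0" using m by simp
    have "x (Some 1) ^ (m - 1) = 0" "x (Some 2) ^ (m - 1) = 0"
      using x(2)[of "Some 1"] x(2)[of "Some 2"] by (simp_all add: H_def G_def meval_simps)
    \<comment> \<open>With \<open>x_1 = x_2 = 0\<close> the third form reduces to
      \<open>- x_0 ^ 2\<close> for every \<open>t\<close>, so no nontrivial zero can appear on the
      line.\<close>
    then have x12: "x (Some 1) = 0" "x (Some 2) = 0" by simp_all
    then have "x None = 0"
      using x(2)[of None] by (simp add: H_def G_def meval_simps S_def sum_2)
    then show False using x(1) x12 option_2_cases by metis
  qed
  then have "poly q 1 = poly q 0" by (rule poly_nonvanishing_imp_constant)
  then have "res_at id R (H 1) = res_at id R (H 0)" by (simp add: q)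
  moreover have "H 1 = G conic" by (simp add: H_def S_def conic_def)
  moreover have "res_at id R (H 0) = 1"
  proof -
    define F :: "2 option \<Rightarrow> (2 option, complex) mpoly" where "F
        = (\<lambda>i. var i ^ odd_degrees m i)"
    \<comment> \<open>The sign of \<open>- x_0 ^ 2\<close> contributes
      \<open>(-1) ^ ((m - 1) * (m - 1))\<close>, which is 1 for odd \<open>m\<close>.\<close>
    have "H 0 = F(None := const (-1) * F None)"
    proof
      fix i show "H 0 i = (F(None := const (-1) * F None)) i"
        using option_2_cases[of i] by (auto simp: H_def G_def F_def odd_degrees_def const_minus)
    qed
    then have "res_at id R (H 0) = (-1) ^ (\<Prod>j\<in>UNIV - {None}. odd_degrees m j) * res_at id R F"
      by (simp only: res_at_scale[OF R])
    moreover have "UNIV - {None} = {Some (1 :: 2), Some 2}" using option_2_cases by auto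
    then have "(\<Prod>j\<in>UNIV - {None}. odd_degrees m j) = (m - 1) * (m - 1)"
        by (simp add: odd_degrees_def)
    moreover have "res_at id R F = 1" using R unfolding is_resultant_def F_def by blast
    ultimately show ?thesis using m by simp
  qed
  ultimately show ?thesis by (simp add: G_def)
qed

lemma echar_poly_odd:
  assumes m: "m \<ge> 3" "odd m" and R: "is_resultant (odd_degrees m) R3"
  shows "j > 2 * m \<Longrightarrow> poly.coeff (echar_poly R2 R3 m A) j = 0"
    and "poly.coeff (echar_poly R2 R3 m A) (2 * m) = - (((P_sum m A)\<^sup>2
        + (Q_sum m A)\<^sup>2) ^ (m - 2))"
proof -
  define n where "n = m - 1"
  define Phi where "Phi f g = res_at id R3
    ((\<lambda>_. conic)(Some 1 := combination (2 * n) (odd_basis n) f, Some 2 := combination (2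
        * n) (odd_basis n) g))" for f g
  interpret binary_resultant "2 * n" Phi
    unfolding Phi_def n_def by (rule binary_resultant_odd[OF m R])
  obtain k where k: "m = 2 * k + 3"
  proof -
    obtain i where "m = 2 * i + 1" using m by (elim oddE)
    then show thesis using that[of "i - 1"] m by simp
  qed
  have n: "n = 2 * k + 2" by (simp add: n_def k)
  define y :: "2 \<Rightarrow> (2 option, complex) mpoly" where "y = (\<lambda>i. var (Some i))"
  define u v :: "(2 option, complex) mpoly" where "u = y 1 + const \<i> * y 2" and "v = y 1
      - const \<i> * y 2"
  define W :: "(2 option, complex) mpoly" where "W = var None ^ (m - 2)"
  have e: "odd_basis n (2 * j) = u ^ j * v ^ (n - j)" for j
    by (simp add: odd_basis_def u_def v_def y_def Let_def)
  \<comment> \<open>Since \<open>m = n + 1\<close> and \<open>m - 2 = n - 1\<close>, these are the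
    odd exponents on either side of \<open>n\<close>, each lifted with the power
    \<open>m - 2\<close> of \<open>x_0\<close>.\<close>
  have eM: "odd_basis n m = W * u" "odd_basis n (m - 2) = W * v"
    by (simp_all add: odd_basis_def u_def v_def y_def Let_def W_def n k)
  have m2n: "m \<le> 2 * n" by (simp add: n k)
  note comb = combination_power[of 2 u y v m "odd_basis n", folded n_def, OF _ u_def v_def e]
    combination_pencil[of 2 u y v m "odd_basis n" m W, folded n_def, OF _ u_def v_def e m2n eM]
  have forms: "(\<lambda>i. coeff_eval l (odd_forms m A i))
     = (\<lambda>_. conic)(Some 1 := tensor_apply m (\<lambda>is. const (A is)) y 1 - const l * W * y 1,
               Some 2 := tensor_apply m (\<lambda>is. const (A is)) y 2 - const l * W * y 2)" for l
  proof
    fix i :: "2 option"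
    have "coeff_eval l (odd_forms m A i) = (case i of
        Some i \<Rightarrow> tensor_apply m (\<lambda>is. const (A is)) y i - const l * W
            * y i | None \<Rightarrow> conic)"
      by (simp add: odd_forms_def coeff_eval_diff coeff_eval_tensor_apply coeff_eval_mult
          coeff_eval_power coeff_eval_sum lam_def W_def conic_def y_def split: option.split)
    then show "coeff_eval l (odd_forms m A i)
      = ((\<lambda>_. conic)(Some 1 := tensor_apply m (\<lambda>is. const (A is)) y 1 - const l * W
          * y 1,
               Some 2 := tensor_apply m (\<lambda>is. const (A is)) y 2 - const l * W * y 2)) i"
      using option_2_cases[of i] by auto
  qed
  have norm: "Phi (stretch 2 n ([:1/2, 1/2:] ^ n)) (stretch 2 n ([:\<i>/2, -\<i>/2:] ^ n)) = 1"
    using comb(1,2) res_at_conic[OF m R] by (simp add: Phi_def y_def n_def)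
  have psi: "poly (echar_poly R2 R3 m A) l = Phi
      (stretch 2 n (tensor_poly m A 1) - smult l (smult (1/2) (monom 1 m + monom 1 (m - 2))))
      (stretch 2 n (tensor_poly m A 2) - smult l (smult (-\<i>/2) (monom 1 m - monom 1 (m - 2))))" for l
    using m comb(3,4) unfolding echar_poly_def Phi_def by (simp add: poly_res_at forms del: smult_smult)
  have hyps: "m \<ge> 2" "2 * n = 2 * (m - 1)" "(1 :: nat) \<le> 2" "2 \<le> m" "2 * n + 2 = 2 * m"
    by (simp_all add: n_def k)
  note coeffs = coeff_tensor_pencil[OF hyps, folded n_def, OF norm psi]
  show "poly.coeff (echar_poly R2 R3 m A) j = 0" if "j > 2 * m"
    by (rule coeffs(1)[OF that])
  \<comment> \<open>The powers of 16 and \<open>1/16\<close> cancel; the minus sign of the odd case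
    is \<open>(-1) ^ (2 + m)\<close>.\<close>
  have "(- 2 * \<i>) ^ ((m - 2) * (2 * n)) * (-1) ^ (2 + m) * (1/4) ^ (n * (m - 2)) = -1"
  proof -
    have "(m - 2) * (2 * n) = 4 * ((k + 1) * (m - 2))" by (simp add: n)
    moreover have "(- 2 * \<i>) ^ 4 = 16" by (simp add: power4_eq_xxxx)
    ultimately have "(- 2 * \<i>) ^ ((m - 2) * (2 * n)) = 16 ^ ((k + 1) * (m - 2))"
      by (simp only: power_mult)
    moreover have "n * (m - 2) = 2 * ((k + 1) * (m - 2))" by (simp add: n)
    then have "(1/4 :: complex) ^ (n * (m - 2)) = ((1/4) ^ 2) ^ ((k + 1) * (m - 2))"
      by (simp only: power_mult)
    moreover have "(-1 :: complex) ^ (2 + m) = -1" using m by simp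
    moreover have "(16 :: complex) ^ j * ((1/4) ^ 2) ^ j = 1" for j
      by (simp add: power2_eq_square flip: power_mult_distrib)
    ultimately show ?thesis by simp
  qed
  then show "poly.coeff (echar_poly R2 R3 m A) (2 * m) = - (((P_sum m A)\<^sup>2
      + (Q_sum m A)\<^sup>2) ^ (m - 2))"
    using coeffs(2) by simp
qed

section \<open>The leading coefficient\<close>

text \<open>A tensor with \<open>P^2 + Q^2 = 1\<close>: it shows that the coefficient with index
  \<open>m\<close> is not the zero polynomial in the entries.\<close>

lemma P_Q_sum_unit_tensor:
  assumes "m \<ge> 1"
  shows "P_sum m (\<lambda>is. if is = replicate m 1 then 1 else 0) = 1"
    and "Q_sum m (\<lambda>is. if is = replicate m 1 then 1 else 0) = 0"
proof -
  define A :: "2 list \<Rightarrow> complex" where "A is = (if is = replicate m 1 then 1 else 0)" for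
      "is"
  obtain n where m: "m = Suc n" using assms by (cases m) auto
  have "P_sum m A + t * Q_sum m A = 1" if "t ^ 2 = -1" for t
  proof -
    have "(\<Sum>is | length is = m - 1. A (1 # is) * t ^ count_list is 2)
       = (\<Sum>is | length is = n. if is = replicate n 1 then t ^ count_list is (2 :: 2) else 0)"
      by (rule sum.cong) (auto simp: A_def m)
    also have "\<dots> = t ^ count_list (replicate n 1) (2 :: 2)"
      using finite_index_lists[of n] by simp
    also have "count_list (replicate n 1) (2 :: 2) = 0"
      by (simp add: count_list_0_iff)
    finally have "(\<Sum>is | length is = m - 1. A (1 # is) * t ^ count_list is 2) = 1" by simp
    moreover have "A (2 # is) = 0" for "is" by (simp add: A_def m)
    ultimately show ?thesis using P_Q_sum_eq[OF assms that, of A] by simp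
  qed
  \<comment> \<open>The two values of \<open>t\<close> separate \<open>P\<close> from
    \<open>Q\<close>.\<close>
  from this[of \<i>] this[of "-\<i>"] have "P_sum m A + \<i> * Q_sum m A = 1" "P_sum m A - \<i>
      * Q_sum m A = 1"
    by simp_all
  then have "P_sum m A = 1 \<and> Q_sum m A = 0"
    using isotropic_values_zero[of "P_sum m A - 1" "Q_sum m A"] by (simp add: algebra_simps)
  then show "P_sum m (\<lambda>is. if is = replicate m 1 then 1 else 0) = 1"
    "Q_sum m (\<lambda>is. if is = replicate m 1 then 1 else 0) = 0"
    by (simp_all add: A_def[abs_def])
qed

theorem theorem9:
  fixes m :: nat and A :: "2 list \<Rightarrow> complex"
    and R2 :: "2 res_poly" and R3 :: "2 option res_poly"
  assumes "m \<ge> 2"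
    and "finite (eigenpairs m A // eigenpair_equiv m A)"
    and "even m \<Longrightarrow> is_resultant (even_degrees m) R2"
    and "odd m \<Longrightarrow> is_resultant (odd_degrees m) R3"
  shows "(even m \<longrightarrow> echar_coeff R2 R3 m (echar_h R2 R3 m) A
             = ((P_sum m A)\<^sup>2 + (Q_sum m A)\<^sup>2) ^ ((m - 2) div 2))
       \<and> (odd m \<longrightarrow> echar_coeff R2 R3 m (echar_h R2 R3 m) A
             = - (((P_sum m A)\<^sup>2 + (Q_sum m A)\<^sup>2) ^ (m - 2)))"
proof -
  have m3: "m \<ge> 3" if "odd m" using that assms(1) by (cases "m = 2") auto
  have lead: "echar_coeff R2 R3 m m B = (if even m then ((P_sum m B)\<^sup>2
      + (Q_sum m B)\<^sup>2) ^ ((m - 2) div 2)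
     else - (((P_sum m B)\<^sup>2 + (Q_sum m B)\<^sup>2) ^ (m - 2)))" for B
    using echar_poly_even(2)[OF assms(1) _ assms(3)] echar_poly_odd(2)[OF m3 _ assms(4)]
    by (simp add: echar_coeff_def)
  have vanish: "echar_coeff R2 R3 m j B = 0" if "j > m" for j B
    using echar_poly_even(1)[OF assms(1) _ assms(3), of j] echar_poly_odd(1)[OF m3 _ assms(4), of "2
        * j"] that
    by (simp add: echar_coeff_def)
  \<comment> \<open>The unit tensor bounds the index from below; vanishing beyond \<open>m\<close>
    for every tensor bounds it from above.\<close>
  have "echar_h R2 R3 m = m"
    unfolding echar_h_def
  proof (rule Greatest_equality)
    have "echar_coeff R2 R3 m m (\<lambda>is. if is = replicate m 1 then 1 else 0) \<noteq> 0"
      using assms(1) by (simp add: lead P_Q_sum_unit_tensor)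
    then show "\<exists>B. echar_coeff R2 R3 m m B \<noteq> 0" by blast
  next
    fix j assume "\<exists>B. echar_coeff R2 R3 m j B \<noteq> 0"
    then show "j \<le> m" using vanish by (metis linorder_le_less_linear)
  qed
  then show ?thesis by (simp add: lead)
qed

end
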